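(* Let $d\ge1$. Every acyclic system of permutations on the edges of $3\Delta_{d-1}$ is achievable as the system of permutations $\sigma(S)$ of a fine mixed subdivision $S$ of $3\Delta_{d-1}$.
   Context: Notation: $[m]=\{1,\dots,m\}$. $\Delta_{d-1}$ is the convex hull of the standard basis vectors $w_1,\dots,w_d$ of $\mathbb R^d$, and $n\Delta_{d-1}$ is its dilation by $n$, with vertices $nw_1,\dots,nw_d$. A (nonempty) face of $\Delta_{d-1}$ is identified with its set of vertices; $w_aw_b$ denotes the edge with vertices $w_a,w_b$. The claim uses the following definitions with $n=3$. Systems of permutations: a system of permutations on the edges of $n\Delta_{d-1}$ is a collection $\sigma=(\sigma_{ab})_{1\le a\neq b\le d}$ of permutations of $[n]$ (written as words in one-line notation) such that the word $\sigma_{ab}$ is the reverse of the word $\sigma_{ba}$ for all $a\ne b$. For $i\ne j$ in $[n]$, $G_{ij}(\sigma)$ is the directed complete graph on $[d]$ in which the edge $ab$ is directed $a\to b$ if and only if $i$ appears before $j$ in the word $\sigma_{ab}$. The system $\sigma$ is acyclic if all graphs $G_{ij}(\sigma)$ have no directed cycle. Fine mixed subdivisions: a fine mixed cell is a Minkowski sum $B_1+\cdots+B_n$ of nonempty faces $B_i$ of $\Delta_{d-1}$ which lie in independent affine subspaces (i.e. $\dim(B_1+\cdots+B_n)=\sum_i\dim B_i$) and whose dimensions add up to $d-1$. A fine mixed subdivision $S$ of $n\Delta_{d-1}$ is a polyhedral subdivision of $n\Delta_{d-1}$ into fine mixed cells such that the intersection of any two cells is a face of both. Its cells (of all dimensions)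 are labeled by ordered Minkowski sums $S_1+\cdots+S_n$ of nonempty faces of $\Delta_{d-1}$ in such a way that if $B_1+\cdots+B_n$ is a face of $C_1+\cdots+C_n$ then $B_i$ is a face of $C_i$ for each $i$; such a labeling always exists and is part of the data of $S$. System of permutations of a subdivision: for $a\ne b$ in $[d]$ and $r\in[n]$ there is a unique cell of $S$ having $r-1$ summands equal to $w_b$, $n-r$ summands equal to $w_a$ and one summand equal to $w_aw_b$; let $\sigma_{ab}(r)\in[n]$ be the index of the summand equal to $w_aw_b$. Then $\sigma_{ab}$ is a permutation of $[n]$, and $\sigma(S)=(\sigma_{ab})_{1\le a\ne b\le d}$. *)

theory Defs
  imports "HOL-Analysis.Analysis" "HOL-Combinatorics.Multiset_Permutations"
begin

text \<open>
  The index set $[d]$ is a finite type \<open>'d\<close> (automatically nonempty, so \<open>d \<ge> 1\<close>), and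
  \<open>\<real>\<^sup>d\<close> is \<open>real ^ 'd\<close>.
\<close>

section \<open>Systems of permutations\<close>

text \<open>
  Permutations of \<open>{1..n}\<close> are words, i.e. lists.  The diagonal values \<open>\<sigma> a a\<close> are
  irrelevant junk throughout.
\<close>

definition system_of_permutations :: "nat \<Rightarrow> ('d \<Rightarrow> 'd \<Rightarrow> nat list) \<Rightarrow> bool" where
  "system_of_permutations n \<sigma> \<longleftrightarrow>
     (\<forall>a b. a \<noteq> b \<longrightarrow> \<sigma> a b \<in> permutations_of_set {1..n} \<and> \<sigma> a b = rev (\<sigma> b a))"

definition appears_before :: "'a \<Rightarrow> 'a \<Rightarrow> 'a list \<Rightarrow> bool" where
  "appears_before i j w \<longleftrightarrow> (\<exists>p q. p < q \<and> q < length w \<and> w ! p = i \<and> w ! q = j)"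

definition order_graph :: "nat \<Rightarrow> nat \<Rightarrow> ('d \<Rightarrow> 'd \<Rightarrow> nat list) \<Rightarrow> ('d \<times> 'd) set" where
  "order_graph i j \<sigma> = {(a, b). a \<noteq> b \<and> appears_before i j (\<sigma> a b)}"

definition acyclic_system :: "nat \<Rightarrow> ('d \<Rightarrow> 'd \<Rightarrow> nat list) \<Rightarrow> bool" where
  "acyclic_system n \<sigma> \<longleftrightarrow>
     (\<forall>i\<in>{1..n}. \<forall>j\<in>{1..n}. i \<noteq> j \<longrightarrow> acyclic (order_graph i j \<sigma>))"

section \<open>Fine mixed subdivisions\<close>

definition simplex_vertex :: "'d::finite \<Rightarrow> real ^ 'd" where
  "simplex_vertex a = axis a 1"

text \<open>Faces of the standard simplex are given by their vertex sets \<open>I\<close>.\<close>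

definition simplex_face :: "'d::finite set \<Rightarrow> (real ^ 'd) set" where
  "simplex_face I = convex hull (simplex_vertex ` I)"

definition dilated_simplex :: "nat \<Rightarrow> (real ^ 'd::finite) set" where
  "dilated_simplex n = (\<lambda>x. real n *\<^sub>R x) ` simplex_face UNIV"

text \<open>
  A tuple \<open>(B 1, \<dots>, B n)\<close> of faces is a function on \<open>nat\<close> of which only the values on
  \<open>{1..n}\<close> matter.  The sum below is the Minkowski sum (addition of sets).
\<close>

definition mixed_sum :: "nat \<Rightarrow> (nat \<Rightarrow> 'd::finite set) \<Rightarrow> (real ^ 'd) set" where
  "mixed_sum n B = (\<Sum>i\<in>{1..n}. simplex_face (B i))"

definition fine_mixed_cell :: "nat \<Rightarrow> (real ^ 'd::finite) set \<Rightarrow> bool" where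
  "fine_mixed_cell n C \<longleftrightarrow>
     (\<exists>B. (\<forall>i\<in>{1..n}. B i \<noteq> {}) \<and>
          C = mixed_sum n B \<and>
          aff_dim (mixed_sum n B) = (\<Sum>i\<in>{1..n}. aff_dim (simplex_face (B i))) \<and>
          (\<Sum>i\<in>{1..n}. aff_dim (simplex_face (B i))) = int CARD('d) - 1)"

text \<open>
  A subdivision is given by its set \<open>S\<close> of maximal cells; the cells of all dimensions are the
  nonempty faces of these.  Note that \<open>{} face_of C\<close> holds in the library, so that
  maximal cells may be disjoint.
\<close>

definition fine_mixed_subdivision :: "nat \<Rightarrow> (real ^ 'd::finite) set set \<Rightarrow> bool" where
  "fine_mixed_subdivision n S \<longleftrightarrow>
     finite S \<and>
     (\<forall>C\<in>S. fine_mixed_cell n C) \<and>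
     \<Union>S = dilated_simplex n \<and>
     (\<forall>C\<in>S. \<forall>D\<in>S. (C \<inter> D) face_of C \<and> (C \<inter> D) face_of D)"

definition cells :: "(real ^ 'd::finite) set set \<Rightarrow> (real ^ 'd) set set" where
  "cells S = {F. F \<noteq> {} \<and> (\<exists>C\<in>S. F face_of C)}"

definition mixed_labeling ::
  "nat \<Rightarrow> (real ^ 'd::finite) set set \<Rightarrow> ((real ^ 'd) set \<Rightarrow> nat \<Rightarrow> 'd set) \<Rightarrow> bool" where
  "mixed_labeling n S L \<longleftrightarrow>
     (\<forall>F\<in>cells S. (\<forall>i\<in>{1..n}. L F i \<noteq> {}) \<and> F = mixed_sum n (L F)) \<and>
     (\<forall>F\<in>cells S. \<forall>G\<in>cells S. F face_of G \<longrightarrow> (\<forall>i\<in>{1..n}. L F i \<subseteq> L G i))"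

section \<open>The system of permutations of a subdivision\<close>

text \<open>
  \<open>edge_label n a b r B\<close> with \<open>1 \<le> r \<le> n\<close>: the counts add up to \<open>n\<close>, so they account for
  all summands and determine the Minkowski sum.  Hence \<open>edge_cell\<close> is unique when it exists.
\<close>

definition edge_label :: "nat \<Rightarrow> 'd \<Rightarrow> 'd \<Rightarrow> nat \<Rightarrow> (nat \<Rightarrow> 'd set) \<Rightarrow> bool" where
  "edge_label n a b r B \<longleftrightarrow>
     card {i\<in>{1..n}. B i = {b}} = r - 1 \<and>
     card {i\<in>{1..n}. B i = {a}} = n - r \<and>
     card {i\<in>{1..n}. B i = {a, b}} = 1"

definition edge_cell ::
  "nat \<Rightarrow> (real ^ 'd::finite) set set \<Rightarrow> ((real ^ 'd) set \<Rightarrow> nat \<Rightarrow> 'd set) \<Rightarrow>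
   'd \<Rightarrow> 'd \<Rightarrow> nat \<Rightarrow> (real ^ 'd) set" where
  "edge_cell n S L a b r = (THE F. F \<in> cells S \<and> edge_label n a b r (L F))"

definition subdivision_system ::
  "nat \<Rightarrow> (real ^ 'd::finite) set set \<Rightarrow> ((real ^ 'd) set \<Rightarrow> nat \<Rightarrow> 'd set) \<Rightarrow>
   'd \<Rightarrow> 'd \<Rightarrow> nat list" where
  "subdivision_system n S L a b =
     map (\<lambda>r. THE i. i \<in> {1..n} \<and> L (edge_cell n S L a b r) i = {a, b}) [1..<n + 1]"

end

theory Submission
  imports Defs
begin

text \<open>
  A labelled cell is a bipartite graph between the summands \<open>1, \<dots>, n\<close> and the vertices of the
  simplex, in which \<open>i\<close> is joined to the elements of \<open>B i\<close>.  A point of the cell is the vector of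
  column sums of a transport plan on this graph: every \<open>i\<close> sends out mass 1 along its edges.  All
  the geometry reduces to one combinatorial relation between two graphs, \<open>compatible\<close>: the
  difference of a plan on the first and a plan on the second with the same column sums must vanish,
  i.e. no cycle alternates between edges of the two graphs.  If all members of a family are
  pairwise compatible then every point has only one plan in the whole family, so that two cells
  meet in the cell of the common edges, subgraphs are faces, every face has a well-defined label,
  and the Minkowski sums have independent summands.  If moreover the cells contain all
  points of the dilated simplex with positive rational coordinates, then the cells of full dimension already cover
  (\<open>full_cells_cover\<close>), because the others lie in finitely many proper subspaces.

  For three letters, an acyclic system amounts to three linear orders \<open>f, g, h\<close> of the vertices, one
  for each of the pairs \<open>12\<close>, \<open>23\<close>, \<open>13\<close>, such that \<open>h\<close> agrees with \<open>f\<close> and \<open>g\<close> wherever these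
  two agree.  The picture behind the proof is dual: every vertex \<open>a\<close> is a tripod in the plane which
  separates three sectors \<open>1, 2, 3\<close>, the orders are those in which parallel legs lie, and a point of
  the plane determines a graph, \<open>i\<close> being joined to \<open>a\<close> if the point lies in the closed sector \<open>i\<close>
  of \<open>a\<close>.  The legs \<open>12\<close> and \<open>23\<close> can be taken to be straight, horizontal to the left and vertical
  downwards.  In general the legs \<open>13\<close> cannot be straight as well, since the orders need not come from
  linear functions.  The routing is the canonical one: the region above the leg \<open>13\<close> of \<open>c\<close> is the union of
  the upper left quadrants at the apices of all \<open>e\<close> with \<open>h c \<le> h e\<close>, its smallest possible value.
  This decides every triple of tripods whose mutual position the orders leave open, and it gives
  the last two conditions in the definition of \<open>cell_family\<close>.  Alternating cycles with three
  summands have length 4 or 6; the orders exclude length 4, and the routing excludes length 6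
  (\<open>cell_family_compatible\<close>).

  That the cells cover a rational point means that some position in the plane distributes given
  masses of the vertices evenly over the three sectors.  Splitting each vertex into unit masses
  turns this into a statement about generic positions, proved by moving the position
  one crossing at a time (\<open>bij_rank_cut\<close>, \<open>three_order_partition\<close>, \<open>cell_family_cover\<close>).  Finally, on
  an edge \<open>ab\<close> the first three conditions of \<open>cell_family\<close> say in which order the summands may pass
  from \<open>a\<close> to \<open>b\<close>, and this order is the given word (\<open>subdivision_system_label\<close>).
\<close>

section \<open>Transport plans\<close>

text \<open>Row \<open>i\<close> of a plan holds the barycentric coordinates of a point of the \<open>i\<close>-th summand.\<close>

definition plan :: "nat \<Rightarrow> (nat \<Rightarrow> 'd::finite set) \<Rightarrow> (nat \<Rightarrow> 'd \<Rightarrow> real) \<Rightarrow> bool" where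
  "plan n B X \<longleftrightarrow>
     (\<forall>i\<in>{1..n}. (\<forall>a. 0 \<le> X i a) \<and> (\<forall>a. a \<notin> B i \<longrightarrow> X i a = 0) \<and> (\<Sum>a\<in>UNIV. X i a) = 1)"

definition plan_sum :: "nat \<Rightarrow> (nat \<Rightarrow> 'd::finite \<Rightarrow> real) \<Rightarrow> real ^ 'd" where
  "plan_sum n X = (\<chi> a. \<Sum>i\<in>{1..n}. X i a)"

lemma mem_simplex_face:
  fixes x :: "real ^ 'd::finite"
  shows "x \<in> simplex_face I \<longleftrightarrow>
    (\<forall>a. 0 \<le> x $ a) \<and> (\<forall>a. a \<notin> I \<longrightarrow> x $ a = 0) \<and> (\<Sum>a\<in>UNIV. x $ a) = 1"
proof -
  have inj: "inj (simplex_vertex :: 'd \<Rightarrow> real ^ 'd)"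
    by (auto simp: inj_def simplex_vertex_def axis_eq_axis)
  have comp: "(\<Sum>b\<in>I. u b *\<^sub>R simplex_vertex b) $ a = (if a \<in> I then u a else 0)"
    for u :: "'d \<Rightarrow> real" and a
    by (simp add: simplex_vertex_def axis_def if_distrib [of "\<lambda>z. _ * z"] cong: if_cong)
  show ?thesis
  proof
    assume "x \<in> simplex_face I"
    then obtain u where u: "\<forall>v\<in>simplex_vertex ` I. 0 \<le> u v" "sum u (simplex_vertex ` I) = 1"
      "(\<Sum>v\<in>simplex_vertex ` I. u v *\<^sub>R v) = x"
      unfolding simplex_face_def convex_hull_finite [OF finite_imageI [OF finite]] by blast
    have x: "x = (\<Sum>b\<in>I. u (simplex_vertex b) *\<^sub>R simplex_vertex b)"
      using u(3) by (subst (asm) sum.reindex) (auto intro: inj_on_subset [OF inj])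
    have one: "(\<Sum>b\<in>I. u (simplex_vertex b)) = 1"
      using u(2) by (subst (asm) sum.reindex) (auto intro: inj_on_subset [OF inj])
    show "(\<forall>a. 0 \<le> x $ a) \<and> (\<forall>a. a \<notin> I \<longrightarrow> x $ a = 0) \<and> (\<Sum>a\<in>UNIV. x $ a) = 1"
      unfolding x comp using u(1) one by (simp add: sum.If_cases)
  next
    assume *: "(\<forall>a. 0 \<le> x $ a) \<and> (\<forall>a. a \<notin> I \<longrightarrow> x $ a = 0) \<and> (\<Sum>a\<in>UNIV. x $ a) = 1"
    have eq: "(\<Sum>b\<in>I. (x $ b) *\<^sub>R simplex_vertex b) = x"
      using * by (simp only: vec_eq_iff comp) auto
    have "(\<Sum>b\<in>I. x $ b) = (\<Sum>a\<in>UNIV. x $ a)"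
      by (rule sum.mono_neutral_left) (use * in auto)
    then have one: "(\<Sum>b\<in>I. x $ b) = 1" using * by simp
    have "(\<Sum>b\<in>I. (x $ b) *\<^sub>R simplex_vertex b) \<in> convex hull (simplex_vertex ` I)"
      by (rule convex_sum [OF _ convex_convex_hull one]) (use * in \<open>auto intro: hull_inc\<close>)
    then show "x \<in> simplex_face I" unfolding simplex_face_def eq .
  qed
qed

lemma mem_mixed_sum:
  "x \<in> mixed_sum n B \<longleftrightarrow> (\<exists>X. plan n B X \<and> x = plan_sum n X)"
proof
  assume "x \<in> mixed_sum n B"
  then obtain s where s: "x = sum s {1..n}" "\<forall>i\<in>{1..n}. s i \<in> simplex_face (B i)"
    unfolding mixed_sum_def by (auto simp: set_sum_alt)
  have "plan n B (\<lambda>i a. s i $ a)"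
    using s(2) by (auto simp: plan_def mem_simplex_face)
  moreover have "x = plan_sum n (\<lambda>i a. s i $ a)"
    by (simp add: plan_sum_def vec_eq_iff s(1))
  ultimately show "\<exists>X. plan n B X \<and> x = plan_sum n X" by blast
next
  assume "\<exists>X. plan n B X \<and> x = plan_sum n X"
  then obtain X where X: "plan n B X" "x = plan_sum n X" by blast
  have "x = (\<Sum>i\<in>{1..n}. \<chi> a. X i a)" by (simp add: X(2) plan_sum_def vec_eq_iff)
  moreover have "\<forall>i\<in>{1..n}. (\<chi> a. X i a) \<in> simplex_face (B i)"
    using X(1) by (auto simp: plan_def mem_simplex_face)
  ultimately show "x \<in> mixed_sum n B"
    unfolding mixed_sum_def set_sum_alt [OF finite_atLeastAtMost] by blast
qed

lemma plan_mono: "plan n B X \<Longrightarrow> \<forall>i\<in>{1..n}. B i \<subseteq> B' i \<Longrightarrow> plan n B' X"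
  unfolding plan_def by blast

lemma mixed_sum_cong: "\<forall>i\<in>{1..n}. B i = B' i \<Longrightarrow> mixed_sum n B = mixed_sum n B'"
  unfolding mixed_sum_def by (intro sum.cong) auto

lemma plan_nonempty:
  assumes "plan n B X" "i \<in> {1..n}" shows "\<exists>a\<in>B i. 0 < X i a"
proof (rule ccontr)
  assume "\<not> ?thesis"
  then have "X i a = 0" for a
    using assms by (metis linorder_not_less order_antisym_conv plan_def)
  then have "(\<Sum>a\<in>UNIV. X i a) = 0" by simp
  with assms show False unfolding plan_def by auto
qed

lemma plan_mix:
  assumes "plan n B X" "plan n B Y" "0 \<le> u" "0 \<le> v" "u + v = 1"
  shows "plan n B (\<lambda>i a. u * X i a + v * Y i a)"
  using assms by (auto simp: plan_def sum.distrib simp flip: sum_distrib_left)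

lemma plan_sum_mix:
  "plan_sum n (\<lambda>i a. u * X i a + v * Y i a) = u *\<^sub>R plan_sum n X + v *\<^sub>R plan_sum n Y"
  by (simp add: plan_sum_def vec_eq_iff sum.distrib sum_distrib_left)

lemma convex_mixed_sum: "convex (mixed_sum n B)"
  unfolding mixed_sum_def simplex_face_def by (intro convex_set_sum) simp

lemma compact_mixed_sum: "compact (mixed_sum n (B :: nat \<Rightarrow> 'd::finite set))"
proof -
  have "finite K \<Longrightarrow> compact (\<Sum>i\<in>K. simplex_face (B i))" for K
  proof (induction K rule: finite_induct)
    case empty
    then show ?case by (simp add: set_zero)
  next
    case (insert i K)
    have "compact (simplex_face (B i))"
      unfolding simplex_face_def by (intro finite_imp_compact_convex_hull) simp
    from compact_sums [OF this insert.IH]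
    have "compact (simplex_face (B i) + (\<Sum>i\<in>K. simplex_face (B i)))"
      by (rule back_subst) (auto simp: set_plus_def)
    then show ?case using insert.hyps by simp
  qed
  then show ?thesis unfolding mixed_sum_def by simp
qed

lemma finite_range_mixed_sum: "finite (range (mixed_sum n :: (nat \<Rightarrow> 'd::finite set) \<Rightarrow> _))"
proof (rule finite_subset)
  show "range (mixed_sum n) \<subseteq> mixed_sum n ` (PiE {1..n} (\<lambda>_. UNIV :: 'd set set))"
  proof clarify
    fix B :: "nat \<Rightarrow> 'd set"
    have "mixed_sum n B = mixed_sum n (restrict B {1..n})" by (rule mixed_sum_cong) auto
    then show "mixed_sum n B \<in> mixed_sum n ` (PiE {1..n} (\<lambda>_. UNIV :: 'd set set))" by auto
  qed
  show "finite (mixed_sum n ` (PiE {1..n} (\<lambda>_. UNIV :: 'd set set)))"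
    by (intro finite_imageI finite_PiE) auto
qed

section \<open>Compatible labels\<close>

text \<open>
  Think of \<open>D\<close> as a plan for \<open>B\<close> minus a plan for \<open>B'\<close>.  The quantification over real circulations, in
  place of the alternating cycles that support them, is the form in which the condition is used,
  and \<open>compatible n B B\<close> says that the graph of \<open>B\<close> is a forest.
\<close>

definition compatible :: "nat \<Rightarrow> (nat \<Rightarrow> 'd::finite set) \<Rightarrow> (nat \<Rightarrow> 'd set) \<Rightarrow> bool" where
  "compatible n B B' \<longleftrightarrow> (\<forall>D :: nat \<Rightarrow> 'd \<Rightarrow> real.
     (\<forall>i\<in>{1..n}. (\<Sum>a\<in>UNIV. D i a) = 0) \<longrightarrow> (\<forall>a. (\<Sum>i\<in>{1..n}. D i a) = 0) \<longrightarrow>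
     (\<forall>i\<in>{1..n}. \<forall>a. (0 < D i a \<longrightarrow> a \<in> B i) \<and> (D i a < 0 \<longrightarrow> a \<in> B' i)) \<longrightarrow>
     (\<forall>i\<in>{1..n}. \<forall>a. D i a = 0))"

lemma compatibleD:
  assumes "compatible n B B'" "\<And>i. i \<in> {1..n} \<Longrightarrow> (\<Sum>a\<in>UNIV. D i a) = (0::real)"
    "\<And>a. (\<Sum>i\<in>{1..n}. D i a) = 0"
    "\<And>i a. i \<in> {1..n} \<Longrightarrow> 0 < D i a \<Longrightarrow> a \<in> B i"
    "\<And>i a. i \<in> {1..n} \<Longrightarrow> D i a < 0 \<Longrightarrow> a \<in> B' i" "i \<in> {1..n}"
  shows "D i a = 0"
proof -
  have "(\<forall>i\<in>{1..n}. \<forall>a. D i a = 0)"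
    using spec [OF assms(1) [unfolded compatible_def], of D] assms(2-5) by blast
  with assms(6) show ?thesis by blast
qed

lemma plan_unique:
  assumes "compatible n B B'" "plan n B X" "plan n B' Y" "plan_sum n X = plan_sum n Y" "i \<in> {1..n}"
  shows "X i a = Y i a"
proof -
  have "X i a - Y i a = 0"
  proof (rule compatibleD [OF assms(1) _ _ _ _ assms(5), of "\<lambda>i a. X i a - Y i a"])
    show "(\<Sum>a\<in>UNIV. X i a - Y i a) = 0" if "i \<in> {1..n}" for i
      using assms(2,3) that by (auto simp: plan_def sum_subtractf)
    show "(\<Sum>i\<in>{1..n}. X i a - Y i a) = 0" for a
      using assms(4) by (simp add: plan_sum_def vec_eq_iff sum_subtractf)
    show "a \<in> B i" if "i \<in> {1..n}" "0 < X i a - Y i a" for i a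
      using assms(2,3) that unfolding plan_def by (metis diff_gt_0_iff_gt linorder_not_less)
    show "a \<in> B' i" if "i \<in> {1..n}" "X i a - Y i a < 0" for i a
      using assms(2,3) that unfolding plan_def by (metis diff_less_0_iff_less linorder_not_less)
  qed
  then show ?thesis by simp
qed

lemma mixed_sum_mono: "\<forall>i\<in>{1..n}. B' i \<subseteq> B i \<Longrightarrow> mixed_sum n B' \<subseteq> mixed_sum n B"
proof
  assume *: "\<forall>i\<in>{1..n}. B' i \<subseteq> B i"
  fix x assume "x \<in> mixed_sum n B'"
  then obtain X where "plan n B' X" "x = plan_sum n X" by (auto simp: mem_mixed_sum)
  with plan_mono [OF this(1) *] show "x \<in> mixed_sum n B" by (auto simp: mem_mixed_sum)
qed

lemma mixed_sum_Int:
  assumes "compatible n B B'"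
  shows "mixed_sum n B \<inter> mixed_sum n B' = mixed_sum n (\<lambda>i. B i \<inter> B' i)"
proof (intro equalityI subsetI)
  fix x assume "x \<in> mixed_sum n B \<inter> mixed_sum n B'"
  then obtain X Y where X: "plan n B X" "x = plan_sum n X" and Y: "plan n B' Y" "x = plan_sum n Y"
    by (auto simp: mem_mixed_sum)
  have "X i a = Y i a" if "i \<in> {1..n}" for i a
    using plan_unique [OF assms X(1) Y(1)] X(2) Y(2) that by simp
  then have "plan n (\<lambda>i. B i \<inter> B' i) X"
    using X(1) Y(1) by (auto simp: plan_def)
  with X(2) show "x \<in> mixed_sum n (\<lambda>i. B i \<inter> B' i)" by (auto simp: mem_mixed_sum)
next
  fix x assume x: "x \<in> mixed_sum n (\<lambda>i. B i \<inter> B' i)"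
  have "mixed_sum n (\<lambda>i. B i \<inter> B' i) \<subseteq> mixed_sum n B"
    "mixed_sum n (\<lambda>i. B i \<inter> B' i) \<subseteq> mixed_sum n B'"
    by (rule mixed_sum_mono, simp)+
  with x show "x \<in> mixed_sum n B \<inter> mixed_sum n B'" by blast
qed

text \<open>
  If a convex combination of two plans on \<open>B\<close> is supported on \<open>B'\<close>, then so are both plans, because
  their entries are nonnegative; uniqueness identifies the plan of a point of \<open>mixed_sum n B'\<close> with
  such a combination.
\<close>

lemma mixed_sum_face:
  assumes "compatible n B B" "\<forall>i\<in>{1..n}. B' i \<subseteq> B i"
  shows "mixed_sum n B' face_of mixed_sum n B"
  unfolding face_of_def
proof (intro conjI ballI impI)
  show "mixed_sum n B' \<subseteq> mixed_sum n B" by (rule mixed_sum_mono [OF assms(2)])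
  show "convex (mixed_sum n B')" by (rule convex_mixed_sum)
next
  fix y z x
  assume "y \<in> mixed_sum n B" "z \<in> mixed_sum n B" "x \<in> mixed_sum n B'" "x \<in> open_segment y z"
  then obtain X Y Z where X: "plan n B' X" "x = plan_sum n X" and Y: "plan n B Y" "y = plan_sum n Y"
    and Z: "plan n B Z" "z = plan_sum n Z" by (auto simp: mem_mixed_sum)
  obtain t where t: "0 < t" "t < 1" "x = (1 - t) *\<^sub>R y + t *\<^sub>R z"
    using \<open>x \<in> open_segment y z\<close> by (auto simp: in_segment)
  let ?W = "\<lambda>i a. (1 - t) * Y i a + t * Z i a"
  have W: "plan n B ?W" by (rule plan_mix [OF Y(1) Z(1)]) (use t in auto)
  have "plan_sum n ?W = plan_sum n X" using t X Y Z by (simp add: plan_sum_mix)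
  then have eq: "?W i a = X i a" if "i \<in> {1..n}" for i a
    using plan_unique [OF assms(1) W plan_mono [OF X(1) assms(2)]] that by blast
  have zero: "Y i a = 0 \<and> Z i a = 0" if "i \<in> {1..n}" "a \<notin> B' i" for i a
  proof -
    have "X i a = 0" "0 \<le> Y i a" "0 \<le> Z i a" using X Y Z that by (auto simp: plan_def)
    then show ?thesis using eq [OF that(1), of a] t
      by (smt (verit, best) mult_nonneg_nonneg mult_pos_pos)
  qed
  have "plan n B' Y" "plan n B' Z"
    using Y(1) Z(1) zero by (auto simp: plan_def)
  then show "y \<in> mixed_sum n B'" "z \<in> mixed_sum n B'" using Y(2) Z(2) by (auto simp: mem_mixed_sum)
qed

section \<open>Dimension of a cell\<close>

lemma indexed_independent:
  fixes v :: "'k \<Rightarrow> 'a::real_vector"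
  assumes "finite K"
    and *: "\<And>u k. (\<Sum>k\<in>K. u k *\<^sub>R v k) = 0 \<Longrightarrow> k \<in> K \<Longrightarrow> u k = (0::real)"
  shows "inj_on v K" "independent (v ` K)"
proof -
  show inj: "inj_on v K"
  proof (rule inj_onI, rule ccontr)
    fix j k assume jk: "j \<in> K" "k \<in> K" "v j = v k" "j \<noteq> k"
    let ?u = "\<lambda>x. (if x = j then 1 else 0) - (if x = k then 1 else 0) :: real"
    have "(\<Sum>x\<in>K. ?u x *\<^sub>R v x) = (\<Sum>x\<in>K. (if x = j then v x else 0)) - (\<Sum>x\<in>K. (if x = k then v x else 0))"
      unfolding sum_subtractf [symmetric] by (rule sum.cong) (auto simp: algebra_simps)
    also have "\<dots> = 0" using jk assms(1) by simp
    finally show False using *[of ?u j] jk by simp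
  qed
  show "independent (v ` K)"
    unfolding dependent_finite [OF finite_imageI [OF assms(1)]]
  proof clarify
    fix u k assume u: "(\<Sum>w\<in>v ` K. u w *\<^sub>R w) = 0" and k: "k \<in> K" "u (v k) \<noteq> 0"
    from u have "(\<Sum>k\<in>K. u (v k) *\<^sub>R v k) = 0" by (simp add: sum.reindex [OF inj])
    from *[OF this k(1)] k(2) show False by simp
  qed
qed

text \<open>
  Edge vectors at a vertex \<open>p\<close> with coefficients \<open>u\<close> form a row with zero sum, the entry at \<open>p\<close> being
  forced.  This turns linear relations between edge vectors into circulations.
\<close>

lemma simplex_edges_component:
  fixes p :: "'d::finite"
  shows "(\<Sum>a\<in>I - {p}. u a *\<^sub>R (simplex_vertex a - simplex_vertex p)) $ c =
    (if c = p then - (\<Sum>a\<in>I - {p}. u a) else if c \<in> I then u c else 0)"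
proof (cases "c = p")
  case True
  have "(\<Sum>a\<in>I - {p}. u a *\<^sub>R (simplex_vertex a - simplex_vertex p)) $ c = (\<Sum>a\<in>I - {p}. - u a)"
    unfolding sum_component True by (rule sum.cong) (auto simp: simplex_vertex_def axis_def)
  with True show ?thesis by (simp add: sum_negf)
next
  case False
  have "(\<Sum>a\<in>I - {p}. u a *\<^sub>R (simplex_vertex a - simplex_vertex p)) $ c
      = (\<Sum>a\<in>I - {p}. if a = c then u a else 0)"
    unfolding sum_component using False
    by (intro sum.cong) (auto simp: simplex_vertex_def axis_def)
  with False show ?thesis by simp
qed

text \<open>
  The edge vectors \<open>v (i, a)\<close> of the summands, taken at one chosen vertex \<open>p i\<close> of each, span the
  directions of the cell.  A linear relation between them is a circulation on the graph of \<open>B\<close> and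
  vanishes by compatibility of \<open>B\<close> with itself.
\<close>

lemma aff_dim_mixed_sum:
  fixes B :: "nat \<Rightarrow> 'd::finite set"
  assumes comp: "compatible n B B" and ne: "\<And>i. i \<in> {1..n} \<Longrightarrow> B i \<noteq> {}"
  shows "aff_dim (mixed_sum n B) = (\<Sum>i\<in>{1..n}. int (card (B i)) - 1)"
proof -
  define p where "p i = (SOME a. a \<in> B i)" for i
  have p: "p i \<in> B i" if "i \<in> {1..n}" for i
    unfolding p_def using ne [OF that] by (simp add: some_in_eq)
  define K where "K = Sigma {1..n} (\<lambda>i. B i - {p i})"
  define v :: "nat \<times> 'd \<Rightarrow> real ^ 'd"
    where "v k = simplex_vertex (snd k) - simplex_vertex (p (fst k))" for k
  define x0 :: "real ^ 'd" where "x0 = (\<Sum>i\<in>{1..n}. simplex_vertex (p i))"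
  have finK: "finite K" by (simp add: K_def)
  have vsum: "(\<Sum>k\<in>K. u k *\<^sub>R v k) $ c = (\<Sum>i\<in>{1..n}.
      (if c = p i then - (\<Sum>a\<in>B i - {p i}. u (i, a)) else if c \<in> B i then u (i, c) else 0))"
    for u c
  proof -
    have "(\<Sum>k\<in>K. u k *\<^sub>R v k) =
      (\<Sum>i\<in>{1..n}. \<Sum>a\<in>B i - {p i}. u (i, a) *\<^sub>R (simplex_vertex a - simplex_vertex (p i)))"
      unfolding K_def by (subst sum.Sigma) (auto simp: v_def split_beta)
    then show ?thesis
      by (simp only: sum_component [of _ "{1..n}"] simplex_edges_component)
  qed
  have indep: "inj_on v K" "independent (v ` K)"
  proof -
    have "u k = 0" if "(\<Sum>k\<in>K. u k *\<^sub>R v k) = 0" "k \<in> K" for u k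
    proof -
      define D where "D i c = (if c = p i then - (\<Sum>a\<in>B i - {p i}. u (i, a))
        else if c \<in> B i then u (i, c) else 0)" for i c
      obtain i a where k: "k = (i, a)" "i \<in> {1..n}" "a \<in> B i" "a \<noteq> p i"
        using \<open>k \<in> K\<close> unfolding K_def by blast
      have "D i a = 0"
      proof (rule compatibleD [OF comp _ _ _ _ k(2)])
        show "(\<Sum>a\<in>UNIV. D i a) = 0" for i
        proof -
          have "(\<Sum>a\<in>UNIV - {p i}. D i a) = (\<Sum>a\<in>B i - {p i}. u (i, a))"
            by (rule sum.mono_neutral_cong_right) (auto simp: D_def)
          then show ?thesis
            by (subst sum.remove [of _ "p i"]) (auto simp: D_def)
        qed
        show "(\<Sum>i\<in>{1..n}. D i a) = 0" for a
          using vsum [of u a] that(1) by (simp add: D_def)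
        show "a \<in> B i" if "i \<in> {1..n}" "0 < D i a" for i a
          using that p by (auto simp: D_def split: if_splits)
        show "a \<in> B i" if "i \<in> {1..n}" "D i a < 0" for i a
          using that p by (auto simp: D_def split: if_splits)
      qed
      with k show ?thesis by (simp add: D_def)
    qed
    with indexed_independent [of K v, OF finK] show "inj_on v K" "independent (v ` K)" by blast+
  qed
  have vert: "(\<Sum>i\<in>{1..n}. simplex_vertex (q i)) \<in> mixed_sum n B"
    if "\<And>i. i \<in> {1..n} \<Longrightarrow> q i \<in> B i" for q
    unfolding mixed_sum_def
    by (subst set_sum_alt)
      (use that in \<open>auto simp: simplex_face_def intro!: hull_inc exI [of _ "\<lambda>i. simplex_vertex (q i)"]\<close>)
  have x0: "x0 \<in> mixed_sum n B"
    unfolding x0_def by (rule vert) (rule p)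
  have sub1: "v ` K \<subseteq> (\<lambda>x. x - x0) ` mixed_sum n B"
  proof
    fix w assume "w \<in> v ` K"
    then obtain i a where k: "w = v (i, a)" "i \<in> {1..n}" "a \<in> B i" unfolding K_def by blast
    have "(\<Sum>j\<in>{1..n}. simplex_vertex ((p(i := a)) j)) \<in> mixed_sum n B"
      by (rule vert) (use k p in auto)
    moreover have "(\<Sum>j\<in>{1..n}. simplex_vertex ((p(i := a)) j)) - x0 = w"
    proof -
      have "(\<Sum>j\<in>{1..n}. simplex_vertex ((p(i := a)) j)) - x0
          = (\<Sum>j\<in>{1..n}. if j = i then w else 0)"
        unfolding x0_def sum_subtractf [symmetric]
        by (rule sum.cong) (auto simp: k(1) v_def)
      with k(2) show ?thesis by simp
    qed
    ultimately show "w \<in> (\<lambda>x. x - x0) ` mixed_sum n B" by (metis imageI)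
  qed
  have sub2: "(\<lambda>x. x - x0) ` mixed_sum n B \<subseteq> span (v ` K)"
  proof clarify
    fix x assume "x \<in> mixed_sum n B"
    then obtain X where X: "plan n B X" "x = plan_sum n X" by (auto simp: mem_mixed_sum)
    have "x - x0 = (\<Sum>k\<in>K. X (fst k) (snd k) *\<^sub>R v k)"
      unfolding vec_eq_iff
    proof
      fix c
      have "X i c - simplex_vertex (p i) $ c = (if c = p i then - (\<Sum>a\<in>B i - {p i}. X i a)
          else if c \<in> B i then X i c else 0)" if i: "i \<in> {1..n}" for i
      proof -
        have "(\<Sum>a\<in>B i. X i a) = 1"
        proof -
          have "(\<Sum>a\<in>B i. X i a) = (\<Sum>a\<in>UNIV. X i a)"
            by (rule sum.mono_neutral_left) (use X(1) i in \<open>auto simp: plan_def\<close>)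
          then show ?thesis using X(1) i by (simp add: plan_def)
        qed
        then have "X i (p i) + (\<Sum>a\<in>B i - {p i}. X i a) = 1"
          using sum.remove [OF _ p [OF i], of "X i"] by simp
        then show ?thesis
          using X(1) i by (auto simp: plan_def simplex_vertex_def axis_def)
      qed
      then show "(x - x0) $ c = (\<Sum>k\<in>K. X (fst k) (snd k) *\<^sub>R v k) $ c"
        unfolding vsum fst_conv snd_conv by (simp add: X(2) plan_sum_def x0_def sum_subtractf [symmetric])
    qed
    also have "\<dots> \<in> span (v ` K)"
      by (intro span_sum span_scale span_base) auto
    finally show "x - x0 \<in> span (v ` K)" .
  qed
  have "card (v ` K) = card K" by (rule card_image [OF indep(1)])
  have "dim ((\<lambda>x. x - x0) ` mixed_sum n B) = card K"
    by (rule dim_unique [OF sub1 sub2 indep(2) \<open>card (v ` K) = card K\<close>])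
  moreover have "aff_dim (mixed_sum n B) = int (dim ((\<lambda>x. x - x0) ` mixed_sum n B))"
    by (rule aff_dim_eq_dim_subtract) (rule hull_inc [OF x0])
  moreover have "int (card K) = (\<Sum>i\<in>{1..n}. int (card (B i)) - 1)"
  proof -
    have "int (card (B i - {p i})) = int (card (B i)) - 1" if "i \<in> {1..n}" for i
    proof -
      have "card (B i) > 0" using p [OF that] by (auto simp: card_gt_0_iff)
      then show ?thesis using p [OF that] by (simp add: of_nat_diff)
    qed
    then show ?thesis unfolding K_def by (subst card_SigmaI) auto
  qed
  ultimately show ?thesis by simp
qed

text \<open>A single face is a mixed sum with one summand, and zero column sums then force \<open>D = 0\<close>.\<close>

lemma aff_dim_simplex_face:
  assumes "I \<noteq> {}" shows "aff_dim (simplex_face I) = int (card I) - 1"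
proof -
  have "compatible 1 (\<lambda>_. I) (\<lambda>_. I)" by (simp add: compatible_def)
  from aff_dim_mixed_sum [OF this] assms show ?thesis by (simp add: mixed_sum_def)
qed

lemma fine_mixed_cell_mixed_sum:
  fixes B :: "nat \<Rightarrow> 'd::finite set"
  assumes "compatible n B B" "aff_dim (mixed_sum n B) = int CARD('d) - 1"
  shows "fine_mixed_cell n (mixed_sum n B)"
proof -
  have "aff_dim (mixed_sum n B) \<noteq> - 1" using assms(2) by simp
  then have "mixed_sum n B \<noteq> {}" by auto
  then obtain X where "plan n B X" by (auto simp: mem_mixed_sum)
  then have ne: "B i \<noteq> {}" if "i \<in> {1..n}" for i using plan_nonempty that by blast
  have "aff_dim (mixed_sum n B) = (\<Sum>i\<in>{1..n}. aff_dim (simplex_face (B i)))"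
    using aff_dim_mixed_sum [OF assms(1) ne] aff_dim_simplex_face [OF ne] by simp
  with ne assms(2) show ?thesis unfolding fine_mixed_cell_def by (intro exI [of _ B]) auto
qed

section \<open>Labels of faces\<close>

text \<open>
  The label collects the supports of the plans of the points of \<open>F\<close>.  It is defined from the set of
  points alone, so that it is automatically monotone in \<open>F\<close>.
\<close>

definition label ::
  "nat \<Rightarrow> (nat \<Rightarrow> 'd::finite set) set \<Rightarrow> (real ^ 'd) set \<Rightarrow> nat \<Rightarrow> 'd set" where
  "label n \<F> F i = {a. \<exists>B\<in>\<F>. \<exists>X. plan n B X \<and> plan_sum n X \<in> F \<and> 0 < X i a}"

lemma label_mono: "F \<subseteq> G \<Longrightarrow> label n \<F> F i \<subseteq> label n \<F> G i"
  unfolding label_def by blast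

lemma label_sub:
  assumes comp: "\<And>B B'. B \<in> \<F> \<Longrightarrow> B' \<in> \<F> \<Longrightarrow> compatible n B B'"
    and B: "B \<in> \<F>" and sub: "\<forall>i\<in>{1..n}. B' i \<subseteq> B i" and F: "F \<subseteq> mixed_sum n B'"
    and i: "i \<in> {1..n}"
  shows "label n \<F> F i \<subseteq> B' i"
proof
  fix a assume "a \<in> label n \<F> F i"
  then obtain A X where X: "A \<in> \<F>" "plan n A X" "plan_sum n X \<in> F" "0 < X i a"
    by (auto simp: label_def)
  then obtain Y where Y: "plan n B' Y" "plan_sum n X = plan_sum n Y"
    using F by (metis mem_mixed_sum subsetD)
  have "X i a = Y i a"
    using plan_unique [OF comp [OF X(1) B] X(2) plan_mono [OF Y(1) sub] Y(2) i] .
  with X(4) Y(1) i show "a \<in> B' i" unfolding plan_def by force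
qed

lemma uniform_plan:
  assumes "\<And>i. i \<in> {1..n} \<Longrightarrow> B i \<noteq> {}"
  shows "plan n B (\<lambda>i a. if a \<in> B i then 1 / real (card (B i)) else 0)"
  using assms by (auto simp: plan_def sum.If_cases)

lemma label_mixed_sum:
  assumes comp: "\<And>B B'. B \<in> \<F> \<Longrightarrow> B' \<in> \<F> \<Longrightarrow> compatible n B B'"
    and B: "B \<in> \<F>" and sub: "\<forall>i\<in>{1..n}. B' i \<subseteq> B i"
    and ne: "\<And>i. i \<in> {1..n} \<Longrightarrow> B' i \<noteq> {}"
    and i: "i \<in> {1..n}"
  shows "label n \<F> (mixed_sum n B') i = B' i"
proof
  show "label n \<F> (mixed_sum n B') i \<subseteq> B' i"
    by (rule label_sub [OF comp B sub _ i]) auto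
next
  let ?X = "\<lambda>i a. if a \<in> B' i then 1 / real (card (B' i)) else 0"
  have X: "plan n B' ?X" by (rule uniform_plan) (rule ne)
  then have "plan_sum n ?X \<in> mixed_sum n B'" by (auto simp: mem_mixed_sum)
  moreover have "plan n B ?X" by (rule plan_mono [OF X sub])
  ultimately have "{a. 0 < ?X i a} \<subseteq> label n \<F> (mixed_sum n B') i"
    using B unfolding label_def by blast
  then show "B' i \<subseteq> label n \<F> (mixed_sum n B') i"
    using ne [OF i] by (auto simp: card_gt_0_iff subset_iff)
qed

text \<open>
  By convexity of \<open>F\<close>, some point of \<open>F\<close> has a plan \<open>X\<close> whose support is the whole label.  From such
  a point one can move a little away from any point \<open>z\<close> of the mixed sum of the label without leaving
  the cell, so it lies inside a segment which starts at \<open>z\<close>; as \<open>F\<close> is a face, \<open>z\<close> lies in \<open>F\<close>.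
\<close>

lemma face_has_label:
  assumes comp: "\<And>B B'. B \<in> \<F> \<Longrightarrow> B' \<in> \<F> \<Longrightarrow> compatible n B B'"
    and B: "B \<in> \<F>" and F: "F face_of mixed_sum n B" "F \<noteq> {}"
  shows "\<forall>i\<in>{1..n}. label n \<F> F i \<noteq> {}" "F = mixed_sum n (label n \<F> F)"
proof -
  have FB: "F \<subseteq> mixed_sum n B" using F(1) by (rule face_of_imp_subset)
  have plans: "\<exists>X. plan n B X \<and> plan_sum n X = x" if "x \<in> F" for x
    using that FB by (metis mem_mixed_sum subsetD)
  have labels: "plan n (label n \<F> F) X" if "plan n B X" "plan_sum n X \<in> F" for X
    unfolding plan_def
  proof (intro ballI conjI allI impI)
    fix i assume i: "i \<in> {1..n}"
    show nonneg: "0 \<le> X i a" for a using that(1) i by (simp add: plan_def)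
    show "X i a = 0" if "a \<notin> label n \<F> F i" for a
    proof (rule ccontr)
      assume "X i a \<noteq> 0"
      with nonneg [of a] have "0 < X i a" by simp
      with that B \<open>plan n B X\<close> \<open>plan_sum n X \<in> F\<close> show False unfolding label_def by blast
    qed
    show "(\<Sum>a\<in>UNIV. X i a) = 1" using that(1) i by (simp add: plan_def)
  qed
  obtain x0 where "x0 \<in> F" using F(2) by blast
  then obtain X0 where X0: "plan n B X0" "plan_sum n X0 \<in> F" using plans by blast
  show ne: "\<forall>i\<in>{1..n}. label n \<F> F i \<noteq> {}"
    using plan_nonempty [OF labels [OF X0]] by blast
  define supp where "supp X = {(i, a). i \<in> {1..n} \<and> (0::real) < X i a}" for X :: "nat \<Rightarrow> 'a \<Rightarrow> real"
  have fin: "finite (supp X)" for X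
    by (rule finite_subset [of _ "{1..n} \<times> UNIV"]) (auto simp: supp_def)
  have bound: "card (supp X) \<le> card ({1..n} \<times> (UNIV :: 'a set))" for X
    by (rule card_mono) (auto simp: supp_def)
  obtain X where X: "plan n B X" "plan_sum n X \<in> F"
    and max: "\<And>Y. plan n B Y \<Longrightarrow> plan_sum n Y \<in> F \<Longrightarrow> card (supp Y) \<le> card (supp X)"
    using ex_has_greatest_nat [of "\<lambda>X. plan n B X \<and> plan_sum n X \<in> F" X0 "\<lambda>X. card (supp X)"
      "Suc (card ({1..n} \<times> (UNIV :: 'a set)))"] X0 bound by (auto simp: less_Suc_eq_le)
  have pos: "0 < X i a" if i: "i \<in> {1..n}" and a: "a \<in> label n \<F> F i" for i a
  proof -
    obtain A Y' where Y': "A \<in> \<F>" "plan n A Y'" "plan_sum n Y' \<in> F" "0 < Y' i a"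
      using a unfolding label_def by blast
    then obtain Y where Y: "plan n B Y" "plan_sum n Y = plan_sum n Y'" using plans by blast
    have Yia: "0 < Y i a"
      using plan_unique [OF comp [OF B Y'(1)] Y(1) Y'(2) Y(2) i, of a] Y'(4) by simp
    \<comment> \<open>the midpoint has the union of both supports, which by maximality is the support of \<open>X\<close>\<close>
    let ?M = "\<lambda>i a. 1/2 * X i a + 1/2 * Y i a"
    have M: "plan n B ?M" by (rule plan_mix [OF X(1) Y(1)]) auto
    have "plan_sum n ?M \<in> F"
      unfolding plan_sum_mix using X(2) Y Y'(3) face_of_imp_convex [OF F(1)]
      by (auto simp: convex_def)
    from max [OF M this] have "card (supp ?M) \<le> card (supp X)" .
    moreover have "supp X \<subseteq> supp ?M"
      using Y(1) by (auto simp: supp_def plan_def intro: add_pos_nonneg)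
    ultimately have "supp X = supp ?M" by (intro card_seteq fin)
    moreover have "(i, a) \<in> supp ?M"
      using X(1) Yia i by (auto simp: supp_def plan_def intro: add_nonneg_pos)
    ultimately show ?thesis by (auto simp: supp_def)
  qed
  show "F = mixed_sum n (label n \<F> F)"
  proof (intro equalityI subsetI)
    fix x assume "x \<in> F"
    then show "x \<in> mixed_sum n (label n \<F> F)"
      using plans labels by (metis mem_mixed_sum)
  next
    fix z assume "z \<in> mixed_sum n (label n \<F> F)"
    then obtain Z where Z: "plan n (label n \<F> F) Z" "z = plan_sum n Z" by (auto simp: mem_mixed_sum)
    have ZB: "plan n B Z"
      by (rule plan_mono [OF Z(1)]) (use label_sub [OF comp B _ FB] in blast)
    \<comment> \<open>a step length for which the extended plan \<open>?W\<close> stays nonnegative; 1 covers an empty support\<close>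
    define e where "e = Min (insert 1 ((\<lambda>(i, a). X i a) ` supp X))"
    have e: "0 < e" "\<And>i a. i \<in> {1..n} \<Longrightarrow> 0 < X i a \<Longrightarrow> e \<le> X i a"
      using fin [of X] by (auto simp: e_def supp_def intro!: Min_le) 
    let ?W = "\<lambda>i a. (1 + e) * X i a + (- e) * Z i a"
    have Wpos: "0 \<le> ?W i a" if i: "i \<in> {1..n}" for i a
    proof (cases "0 < X i a")
      case True
      have "Z i a \<le> (\<Sum>a\<in>UNIV. Z i a)"
        by (rule member_le_sum) (use ZB i in \<open>auto simp: plan_def\<close>)
      then have "e * Z i a \<le> e * 1"
        using ZB i e(1) by (intro mult_left_mono) (auto simp: plan_def)
      moreover have "e \<le> X i a" "0 \<le> e * X i a" using e True i by auto
      ultimately show ?thesis by (simp add: algebra_simps)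
    next
      case False
      then have "a \<notin> label n \<F> F i" using pos i by blast
      then have "Z i a = 0" using Z(1) i by (auto simp: plan_def)
      then show ?thesis using X(1) i e by (auto simp: plan_def)
    qed
    have W: "plan n B ?W"
      unfolding plan_def
    proof (intro ballI conjI allI impI)
      fix i assume i: "i \<in> {1..n}"
      show "0 \<le> ?W i a" for a by (rule Wpos [OF i])
      show "?W i a = 0" if "a \<notin> B i" for a using X(1) ZB i that by (simp add: plan_def)
      show "(\<Sum>a\<in>UNIV. ?W i a) = 1"
        using X(1) ZB i unfolding sum.distrib sum_distrib_left [symmetric] by (simp add: plan_def)
    qed
    show "z \<in> F"
    proof (cases "z = plan_sum n X")
      case True
      with X show ?thesis by simp
    next
      case False
      let ?w = "plan_sum n ?W"
      have w: "?w = (1 + e) *\<^sub>R plan_sum n X + (- e) *\<^sub>R z" unfolding plan_sum_mix Z(2) ..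
      have "plan_sum n X = (1 - 1 / (1 + e)) *\<^sub>R z + (1 / (1 + e)) *\<^sub>R ?w"
      proof -
        have s: "1 / (1 + e) * (1 + e) = 1" "1 - 1 / (1 + e) = 1 / (1 + e) * e"
          using e(1) by (simp_all add: field_simps)
        have "(1 / (1 + e)) *\<^sub>R ?w = (1 / (1 + e) * (1 + e)) *\<^sub>R plan_sum n X - (1 / (1 + e) * e) *\<^sub>R z"
          unfolding w by (simp only: scaleR_add_right scaleR_scaleR) simp
        then show ?thesis unfolding s by simp
      qed
      moreover have "z \<noteq> ?w"
      proof
        assume "z = ?w"
        then have "(1 + e) *\<^sub>R z = (1 + e) *\<^sub>R plan_sum n X" unfolding w by (simp add: algebra_simps)
        with False e(1) show False by simp
      qed
      ultimately have "plan_sum n X \<in> open_segment z ?w"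
        using e(1) unfolding in_segment by (intro conjI exI [of _ "1 / (1 + e)"]) auto
      moreover have "z \<in> mixed_sum n B" "?w \<in> mixed_sum n B"
        using ZB W Z(2) by (auto simp: mem_mixed_sum)
      ultimately show "z \<in> F" using F(1) X(2) unfolding face_of_def by blast
    qed
  qed
qed

section \<open>Covering the dilated simplex\<close>

lemma dilated_simplex_eq:
  assumes "0 < n"
  shows "dilated_simplex n = {x :: real ^ 'd::finite. (\<forall>a. 0 \<le> x $ a) \<and> (\<Sum>a\<in>UNIV. x $ a) = real n}"
proof (intro equalityI subsetI)
  fix x :: "real ^ 'd" assume "x \<in> dilated_simplex n"
  then obtain y where y: "y \<in> simplex_face UNIV" "x = real n *\<^sub>R y"
    unfolding dilated_simplex_def by blast
  then show "x \<in> {x. (\<forall>a. 0 \<le> x $ a) \<and> (\<Sum>a\<in>UNIV. x $ a) = real n}"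
    by (simp add: mem_simplex_face flip: sum_distrib_left)
next
  fix x :: "real ^ 'd" assume x: "x \<in> {x. (\<forall>a. 0 \<le> x $ a) \<and> (\<Sum>a\<in>UNIV. x $ a) = real n}"
  have "(1 / real n) *\<^sub>R x \<in> simplex_face UNIV"
    using x assms by (simp add: mem_simplex_face flip: sum_divide_distrib)
  moreover have "x = real n *\<^sub>R ((1 / real n) *\<^sub>R x)" using assms by simp
  ultimately show "x \<in> dilated_simplex n" unfolding dilated_simplex_def by blast
qed

lemma mixed_sum_subset_dilated_simplex:
  assumes "0 < n" shows "mixed_sum n B \<subseteq> dilated_simplex n"
proof
  fix x assume "x \<in> mixed_sum n B"
  then obtain X where X: "plan n B X" "x = plan_sum n X" by (auto simp: mem_mixed_sum)
  have "(\<Sum>a\<in>UNIV. x $ a) = (\<Sum>i\<in>{1..n}. \<Sum>a\<in>UNIV. X i a)"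
    unfolding X(2) plan_sum_def by (simp add: sum.swap [of _ _ UNIV])
  also have "\<dots> = (\<Sum>i\<in>{1..n}. 1)" using X(1) by (intro sum.cong) (auto simp: plan_def)
  finally show "x \<in> dilated_simplex n"
    using X(1) by (auto simp: dilated_simplex_eq [OF assms] X(2) plan_sum_def plan_def intro!: sum_nonneg)
qed

lemma interior_finite_Union_closed:
  assumes "finite \<A>" "\<And>A. A \<in> \<A> \<Longrightarrow> closed A \<and> interior A = {}"
  shows "interior (\<Union>\<A>) = {}"
  using assms by (induction \<A> rule: finite_induct) (auto simp: interior_closed_Un_empty_interior)

text \<open>
  The cells lie in a hyperplane that misses the origin, so taking the linear span raises the dimension by
  exactly one.
\<close>

lemma dim_mixed_sum:
  fixes B :: "nat \<Rightarrow> 'd::finite set"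
  assumes "0 < n" "aff_dim (mixed_sum n B) \<noteq> int CARD('d) - 1"
  shows "dim (mixed_sum n B) < CARD('d)"
proof -
  let ?H = "{x :: real ^ 'd. (\<chi> a. 1) \<bullet> x = real n}"
  have "mixed_sum n B \<subseteq> ?H"
    using mixed_sum_subset_dilated_simplex [OF assms(1), of B]
    by (auto simp: dilated_simplex_eq [OF assms(1)] inner_vec_def)
  then have "affine hull mixed_sum n B \<subseteq> ?H"
    by (intro hull_minimal) (auto simp: affine_hyperplane)
  then have "0 \<notin> affine hull mixed_sum n B" using assms(1) by auto
  then have "aff_dim (insert 0 (mixed_sum n B)) = aff_dim (mixed_sum n B) + 1"
    by (simp add: aff_dim_insert)
  moreover have "aff_dim (insert 0 (mixed_sum n B)) = int (dim (insert 0 (mixed_sum n B)))"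
    by (rule aff_dim_zero) (simp add: hull_inc)
  moreover have "dim (mixed_sum n B) \<le> CARD('d)" by (metis dim_subset_UNIV DIM_cart DIM_real mult.right_neutral)
  ultimately show ?thesis using assms(2) by (simp add: dim_insert span_zero)
qed

lemma rational_common_denominator:
  fixes q :: "'d::finite \<Rightarrow> real"
  assumes "\<And>a. q a \<in> \<rat>" "\<And>a. 0 < q a"
  obtains K :: nat and m :: "'d \<Rightarrow> nat"
  where "0 < K" "\<And>a. 0 < m a" "\<And>a. q a = real (m a) / real K"
proof -
  have "\<exists>k l :: nat. 0 < k \<and> 0 < l \<and> q a = real k / real l" for a
  proof -
    obtain k l :: nat where "l \<noteq> 0" "\<bar>q a\<bar> = real k / real l"
      using Rats_abs_nat_div_natE [OF assms(1)] by metis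
    then show ?thesis using assms(2) [of a] by (intro exI [of _ k] exI [of _ l]) (auto simp: zero_less_divide_iff)
  qed
  then obtain k l where kl: "\<And>a. 0 < k a" "\<And>a. 0 < (l a :: nat)" "\<And>a. q a = real (k a :: nat) / real (l a)"
    by metis
  have prod: "(\<Prod>b\<in>UNIV. l b) = l a * (\<Prod>b\<in>UNIV - {a}. l b)" for a
    by (rule prod.remove) auto
  show thesis
  proof (rule that [of "\<Prod>b\<in>UNIV. l b" "\<lambda>a. k a * (\<Prod>b\<in>UNIV - {a}. l b)"])
    show "0 < (\<Prod>b\<in>UNIV. l b)" using kl by (simp add: prod_pos)
    show "0 < k a * (\<Prod>b\<in>UNIV - {a}. l b)" for a using kl by (simp add: prod_pos)
    show "q a = real (k a * (\<Prod>b\<in>UNIV - {a}. l b)) / real (\<Prod>b\<in>UNIV. l b)" for a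
    proof -
      have "(\<Prod>b\<in>UNIV - {a}. real (l b)) \<noteq> 0" using kl(2) by (simp add: order_less_imp_not_eq2)
      then show ?thesis unfolding kl(3) prod [of a] by (simp del: prod_zero_iff)
    qed
  qed
qed

lemma rational_point_in_open:
  fixes T :: "(real ^ 'd::finite) set"
  assumes "open T" "T \<noteq> {}"
  obtains q where "q \<in> T" "\<And>a. q $ a \<in> \<rat>"
proof -
  obtain x where x: "x \<in> T" using assms(2) by blast
  then obtain e where e: "0 < e" "ball x e \<subseteq> T" using assms(1) open_contains_ball by blast
  have "\<forall>a. \<exists>r\<in>\<rat>. x $ a < r \<and> r < x $ a + e / CARD('d)"
    using e(1) by (intro allI Rats_dense_in_real) simp
  then obtain r where r: "\<And>a. r a \<in> \<rat>" "\<And>a. x $ a < r a" "\<And>a. r a < x $ a + e / CARD('d)"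
    by metis
  have "norm (x - (\<chi> a. r a)) \<le> (\<Sum>a\<in>UNIV. \<bar>(x - (\<chi> a. r a)) $ a\<bar>)" by (rule norm_le_l1_cart)
  also have "\<dots> < (\<Sum>a\<in>(UNIV :: 'd set). e / CARD('d))"
  proof (rule sum_strict_mono)
    show "\<bar>(x - (\<chi> a. r a)) $ a\<bar> < e / CARD('d)" for a using r(2,3) [of a] by simp
  qed auto
  also have "\<dots> = e" by simp
  finally have "(\<chi> a. r a) \<in> T" using e(2) by (auto simp: dist_norm)
  then show thesis by (rule that) (simp add: r(1))
qed

definition full_cells :: "nat \<Rightarrow> (nat \<Rightarrow> 'd::finite set) set \<Rightarrow> (real ^ 'd) set set" where
  "full_cells n \<F> = {mixed_sum n B |B. B \<in> \<F> \<and> aff_dim (mixed_sum n B) = int CARD('d) - 1}"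

text \<open>
  The hypothesis puts every rational point of the open positive orthant, after rescaling, into some
  cell.  The rays whose rescaled point is missed by the full cells form an open set, and its rational
  points then lie on cells of smaller dimension, whose spans are finitely many proper
  subspaces.  Such a set is empty.  The boundary of the dilated simplex follows by closedness.
\<close>

lemma full_cells_cover:
  fixes \<F> :: "(nat \<Rightarrow> 'd::finite set) set"
  assumes n: "0 < n"
    and cov: "\<And>(m :: 'd \<Rightarrow> nat) M. (\<And>a. 0 < m a) \<Longrightarrow> (\<Sum>a\<in>UNIV. m a) = n * M \<Longrightarrow>
      \<exists>B\<in>\<F>. (\<chi> a. real (m a) / real M) \<in> mixed_sum n B"
  shows "\<Union>(full_cells n \<F>) = dilated_simplex n"
  unfolding full_cells_def
proof
  let ?S = "{mixed_sum n B |B. B \<in> \<F> \<and> aff_dim (mixed_sum n B) = int CARD('d) - 1}"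
  show "\<Union>?S \<subseteq> dilated_simplex n"
    using mixed_sum_subset_dilated_simplex [OF n] by blast
next
  let ?S = "{mixed_sum n B |B. B \<in> \<F> \<and> aff_dim (mixed_sum n B) = int CARD('d) - 1}"
  have finS: "finite ?S" by (rule finite_subset [OF _ finite_range_mixed_sum [of n]]) auto
  have closedS: "closed (\<Union>?S)"
    by (rule closed_Union [OF finS]) (auto simp: compact_imp_closed compact_mixed_sum)
  \<comment> \<open>the radial projection \<open>\<psi>\<close> makes the problem open in the whole space instead of in a hyperplane\<close>
  define W where "W = {x :: real ^ 'd. \<forall>a. 0 < x $ a}"
  define \<psi> where "\<psi> x = (real n / (\<Sum>a\<in>UNIV. x $ a)) *\<^sub>R x" for x :: "real ^ 'd"
  define T where "T = W \<inter> \<psi> -` (- \<Union>?S)"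
  define \<L> :: "(real ^ 'd) set set" where "\<L> = span ` {C \<in> range (mixed_sum n). dim C < CARD('d)}"
  have Wsum: "0 < (\<Sum>a\<in>UNIV. x $ a)" if "x \<in> W" for x
    using that by (auto simp: W_def intro!: sum_pos)
  have openW: "open W"
  proof -
    have "W = (\<Inter>a\<in>UNIV. {x. 0 < x $ a})" by (auto simp: W_def)
    then show ?thesis by (auto intro!: open_Collect_less continuous_intros)
  qed
  have "continuous_on W \<psi>"
    unfolding \<psi>_def using Wsum by (intro continuous_intros) (metis less_irrefl)
  then have openT: "open T"
    unfolding T_def using openW closedS by (intro continuous_open_preimage) auto
  have fin: "finite \<L>" unfolding \<L>_def by (simp add: finite_range_mixed_sum)
  have low: "closed A \<and> interior A = {}" if A: "A \<in> \<L>" for A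
  proof -
    obtain C where C: "A = span C" "dim C < CARD('d)" using A by (auto simp: \<L>_def)
    have "dim (span C) < DIM(real ^ 'd)" using C(2) by simp
    from empty_interior_lowdim [OF this] C(1) show ?thesis by (simp add: closed_subspace)
  qed
  have "T = {}"
  proof (rule ccontr)
    assume "T \<noteq> {}"
    have "T - \<Union>\<L> \<noteq> {}"
    proof
      assume "T - \<Union>\<L> = {}"
      then have "T \<subseteq> interior (\<Union>\<L>)" using openT by (intro interior_maximal) auto
      with interior_finite_Union_closed [OF fin low] \<open>T \<noteq> {}\<close> show False by simp
    qed
    moreover have "open (T - \<Union>\<L>)"
      using openT fin low by (intro open_Diff closed_Union) auto
    ultimately obtain q where q: "q \<in> T - \<Union>\<L>" "\<And>a. q $ a \<in> \<rat>"
      using rational_point_in_open by blast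
    have qW: "q \<in> W" and qS: "\<psi> q \<notin> \<Union>?S" using q(1) by (auto simp: T_def)
    have qpos: "0 < q $ a" for a using qW by (simp add: W_def)
    obtain K :: nat and m :: "'d \<Rightarrow> nat" where K: "0 < K" and m: "\<And>a. 0 < m a"
      and qm: "\<And>a. q $ a = real (m a) / real K"
      using rational_common_denominator [of "\<lambda>a. q $ a"] q(2) qpos by metis
    define M where "M = (\<Sum>a\<in>UNIV. m a)"
    have "\<exists>B\<in>\<F>. (\<chi> a. real (n * m a) / real M) \<in> mixed_sum n B"
    proof (rule cov)
      show "0 < n * m a" for a using n m by simp
      show "(\<Sum>a\<in>UNIV. n * m a) = n * M" by (simp add: M_def sum_distrib_left)
    qed
    moreover have "(\<chi> a. real (n * m a) / real M) = \<psi> q"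
    proof -
      have "(\<Sum>a\<in>UNIV. q $ a) = real M / real K"
        by (simp add: qm M_def sum_divide_distrib)
      then show ?thesis using K by (simp add: \<psi>_def vec_eq_iff qm)
    qed
    ultimately obtain B where B: "B \<in> \<F>" "\<psi> q \<in> mixed_sum n B" by auto
    have "aff_dim (mixed_sum n B) \<noteq> int CARD('d) - 1" using qS B by blast
    then have "span (mixed_sum n B) \<in> \<L>" using dim_mixed_sum [OF n] by (auto simp: \<L>_def)
    moreover have "q \<in> span (mixed_sum n B)"
    proof -
      have "q = ((\<Sum>a\<in>UNIV. q $ a) / real n) *\<^sub>R \<psi> q"
        using n Wsum [OF qW] by (simp add: \<psi>_def)
      with B(2) show ?thesis by (metis span_base span_scale)
    qed
    ultimately show False using q(1) by blast
  qed
  then have inner: "x \<in> \<Union>?S" if "x \<in> W" "(\<Sum>a\<in>UNIV. x $ a) = real n" for x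
    using that n by (auto simp: T_def \<psi>_def)
  show "dilated_simplex n \<subseteq> \<Union>?S"
  proof
    fix x :: "real ^ 'd" assume "x \<in> dilated_simplex n"
    then have x: "0 \<le> x $ a" "(\<Sum>a\<in>UNIV. x $ a) = real n" for a
      by (auto simp: dilated_simplex_eq [OF n])
    \<comment> \<open>approach \<open>x\<close> from the barycentre\<close>
    define c :: "real ^ 'd" where "c = (\<chi> a. real n / CARD('d))"
    define \<gamma> where "\<gamma> t = x + t *\<^sub>R (c - x)" for t :: real
    have "\<gamma> t \<in> \<Union>?S" if "0 < t" "t < 1" for t
    proof (rule inner)
      have "\<gamma> t $ a = (1 - t) * x $ a + t * c $ a" for a by (simp add: \<gamma>_def algebra_simps)
      moreover have "0 < (1 - t) * x $ a + t * c $ a" for a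
        using that x(1) [of a] n by (intro add_nonneg_pos) (auto simp: c_def)
      ultimately show "\<gamma> t \<in> W" by (simp add: W_def)
      show "(\<Sum>a\<in>UNIV. \<gamma> t $ a) = real n"
        using x(2) by (simp add: \<gamma>_def c_def sum.distrib sum_subtractf flip: sum_distrib_left)
    qed
    then have "eventually (\<lambda>t. \<gamma> t \<in> \<Union>?S) (at_right 0)"
      unfolding eventually_at_right_field by (intro exI [of _ 1]) auto
    moreover have "(\<gamma> \<longlongrightarrow> x) (at_right 0)"
      unfolding \<gamma>_def by (auto intro!: tendsto_eq_intros)
    ultimately show "x \<in> \<Union>?S"
      by (rule Lim_in_closed_set [OF closedS _ trivial_limit_at_right_real])
  qed
qed

section \<open>The subdivision of a compatible family\<close>

lemma fine_mixed_subdivision_full_cells: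
  fixes \<F> :: "(nat \<Rightarrow> 'd::finite set) set"
  assumes "0 < n"
    and comp: "\<And>B B'. B \<in> \<F> \<Longrightarrow> B' \<in> \<F> \<Longrightarrow> compatible n B B'"
    and cov: "\<And>(m :: 'd \<Rightarrow> nat) M. (\<And>a. 0 < m a) \<Longrightarrow> (\<Sum>a\<in>UNIV. m a) = n * M \<Longrightarrow>
      \<exists>B\<in>\<F>. (\<chi> a. real (m a) / real M) \<in> mixed_sum n B"
  shows "fine_mixed_subdivision n (full_cells n \<F>)"
  unfolding fine_mixed_subdivision_def
proof (intro conjI ballI)
  show "finite (full_cells n \<F>)"
    unfolding full_cells_def by (rule finite_subset [OF _ finite_range_mixed_sum [of n]]) auto
  show "\<Union>(full_cells n \<F>) = dilated_simplex n"
    by (rule full_cells_cover [OF assms(1) cov])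
  show "fine_mixed_cell n C" if "C \<in> full_cells n \<F>" for C
    using that comp fine_mixed_cell_mixed_sum unfolding full_cells_def by blast
  fix C D assume "C \<in> full_cells n \<F>" "D \<in> full_cells n \<F>"
  then obtain B B' where B: "B \<in> \<F>" "C = mixed_sum n B" and B': "B' \<in> \<F>" "D = mixed_sum n B'"
    by (auto simp: full_cells_def)
  have CD: "C \<inter> D = mixed_sum n (\<lambda>i. B i \<inter> B' i)"
    using mixed_sum_Int [OF comp [OF B(1) B'(1)]] B(2) B'(2) by simp
  have "mixed_sum n (\<lambda>i. B i \<inter> B' i) face_of mixed_sum n B"
    by (rule mixed_sum_face [OF comp [OF B(1) B(1)]]) auto
  then show "C \<inter> D face_of C" using CD B(2) by simp
  have "mixed_sum n (\<lambda>i. B i \<inter> B' i) face_of mixed_sum n B'"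
    by (rule mixed_sum_face [OF comp [OF B'(1) B'(1)]]) auto
  then show "C \<inter> D face_of D" using CD B'(2) by simp
qed

lemma cells_full_cellsE:
  assumes "F \<in> cells (full_cells n \<F>)"
  obtains B where "B \<in> \<F>" "F face_of mixed_sum n B" "F \<noteq> {}"
  using assms by (auto simp: cells_def full_cells_def)

lemma mixed_labeling_label:
  fixes \<F> :: "(nat \<Rightarrow> 'd::finite set) set"
  assumes comp: "\<And>B B'. B \<in> \<F> \<Longrightarrow> B' \<in> \<F> \<Longrightarrow> compatible n B B'"
  shows "mixed_labeling n (full_cells n \<F>) (label n \<F>)"
  unfolding mixed_labeling_def
proof (intro conjI ballI impI)
  fix F assume "F \<in> cells (full_cells n \<F>)"
  then obtain B where B: "B \<in> \<F>" "F face_of mixed_sum n B" "F \<noteq> {}" by (rule cells_full_cellsE)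
  show "label n \<F> F i \<noteq> {}" if "i \<in> {1..n}" for i
    using face_has_label(1) [OF comp B] that by blast
  show "F = mixed_sum n (label n \<F> F)"
    by (rule face_has_label(2) [OF comp B])
next
  fix F G :: "(real ^ 'd) set" and i assume "F face_of G"
  then show "label n \<F> F i \<subseteq> label n \<F> G i"
    by (intro label_mono face_of_imp_subset)
qed

section \<open>The permutations along the edges\<close>

lemma appears_before_nth:
  assumes "distinct w" "p < length w" "q < length w"
  shows "appears_before (w ! p) (w ! q) w \<longleftrightarrow> p < q"
  using assms by (auto simp: appears_before_def nth_eq_iff_index_eq)

lemma appears_before_rev:
  "appears_before i j (rev w) \<longleftrightarrow> appears_before j i w"
proof -
  have "appears_before j i w" if before: "appears_before i j (rev w)" for i j and w :: "'a list"
  proof -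
    obtain p q where pq: "p < q" "q < length w" "rev w ! p = i" "rev w ! q = j"
      using before by (auto simp: appears_before_def)
    then have "w ! (length w - Suc q) = j" "w ! (length w - Suc p) = i"
      by (simp_all add: rev_nth)
    with pq show ?thesis unfolding appears_before_def
      by (intro exI [of _ "length w - Suc q"] exI [of _ "length w - Suc p"]) auto
  qed
  from this [of i j w] this [of j i "rev w"] show ?thesis by auto
qed

lemma appears_before_total:
  assumes "i \<in> set w" "j \<in> set w" "i \<noteq> j"
  shows "appears_before i j w \<or> appears_before j i w"
proof -
  obtain p q where "p < length w" "w ! p = i" "q < length w" "w ! q = j"
    using assms by (metis in_set_conv_nth)
  with assms(3) show ?thesis unfolding appears_before_def by (metis linorder_neqE_nat)
qed

lemma appears_before_trans:
  assumes "distinct w" "appears_before i j w" "appears_before j k w"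
  shows "appears_before i k w"
  using assms unfolding appears_before_def by (metis less_trans nth_eq_iff_index_eq)

lemma initial_segment_nat:
  assumes "finite X" "\<And>p q. p \<in> X \<Longrightarrow> q < p \<Longrightarrow> q \<in> X"
  shows "X = {..<card X}"
proof (rule card_subset_eq)
  show "X \<subseteq> {..<card X}"
  proof
    fix p assume "p \<in> X"
    then have "{..p} \<subseteq> X" using assms(2) by (auto simp: le_less)
    from card_mono [OF assms(1) this] show "p \<in> {..<card X}" by simp
  qed
qed auto

text \<open>
  The condition \<open>ord\<close> says that along \<open>w\<close> no summand can still contain \<open>a\<close> when a later one already contains \<open>b\<close>.
  Hence the positions with value \<open>{b}\<close>, and those with value \<open>{b}\<close> or \<open>{a, b}\<close>, are initial
  segments of \<open>w\<close>, and the counts in \<open>edge_label\<close> give their lengths.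
\<close>

lemma edge_label_determined:
  assumes w: "distinct w" "set w = {1..n}" and ab: "a \<noteq> b" and r: "r \<in> {1..n}"
    and edge: "edge_label n a b r Q"
    and ord: "\<And>i j. i \<in> {1..n} \<Longrightarrow> j \<in> {1..n} \<Longrightarrow> i \<noteq> j \<Longrightarrow> a \<in> Q i \<Longrightarrow> b \<in> Q j \<Longrightarrow>
      appears_before j i w"
    and p: "p < n"
  shows "Q (w ! p) = (if p < r - 1 then {b} else if p = r - 1 then {a, b} else {a})"
proof -
  have len: "length w = n" using distinct_card [OF w(1)] w(2) by simp
  have bij: "bij_betw ((!) w) {..<n} {1..n}" using bij_betw_nth [OF w(1)] len w(2) by auto
  have mem: "w ! q \<in> {1..n}" if "q < n" for q using that len w(2) nth_mem by blast
  have card_pos: "card {q. q < n \<and> P (w ! q)} = card {i \<in> {1..n}. P i}" for P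
  proof -
    have "bij_betw ((!) w) {q \<in> {..<n}. P (w ! q)} {i \<in> {1..n}. P i}"
      by (rule bij_betw_Collect [OF bij]) simp
    then show ?thesis using bij_betw_same_card by fastforce
  qed
  have ne: "{a} \<noteq> {a, b}" "{b} \<noteq> {a, b}" "{a} \<noteq> {b}" using ab by auto
  let ?I = "\<lambda>s. {i \<in> {1..n}. Q i = s}"
  have edge': "card (?I {b}) = r - 1" "card (?I {a}) = n - r" "card (?I {a, b}) = 1"
    using edge by (auto simp: edge_label_def)
  have cardB: "card (?I {b} \<union> ?I {a, b}) = r"
    using edge' r ne by (subst card_Un_disjoint) auto
  have "card (?I {b} \<union> ?I {a, b} \<union> ?I {a}) = n"
    using edge' cardB r ne by (subst card_Un_disjoint) auto
  then have "?I {b} \<union> ?I {a, b} \<union> ?I {a} = {1..n}"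
    by (intro card_subset_eq) auto
  then have all: "Q i = {b} \<or> Q i = {a, b} \<or> Q i = {a}" if "i \<in> {1..n}" for i
    using that by blast
  have before: "q < q'" if "q < n" "q' < n" "q \<noteq> q'" "a \<in> Q (w ! q')" "b \<in> Q (w ! q)" for q q'
    using ord [OF mem [OF that(2)] mem [OF that(1)]] that len w(1)
    by (metis appears_before_nth nth_eq_iff_index_eq)
  let ?X = "{q. q < n \<and> Q (w ! q) = {b}}"
  let ?Y = "{q. q < n \<and> (Q (w ! q) = {b} \<or> Q (w ! q) = {a, b})}"
  have X: "?X = {..<r - 1}"
  proof -
    have "?X = {..<card ?X}"
    proof (rule initial_segment_nat)
      show "q' \<in> ?X" if "q \<in> ?X" "q' < q" for q q'
      proof -
        have q: "q < n" "q' < n" "b \<in> Q (w ! q)" using that by auto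
        then have "a \<in> Q (w ! q') \<Longrightarrow> q < q'" using before [of q q'] \<open>q' < q\<close> by blast
        then have "Q (w ! q') \<noteq> {a}" "Q (w ! q') \<noteq> {a, b}" using \<open>q' < q\<close> by auto
        then show ?thesis using all [OF mem [OF q(2)]] q(2) by blast
      qed
    qed auto
    then show ?thesis using card_pos [of "\<lambda>s. Q s = {b}"] edge'(1) by simp
  qed
  have Y: "?Y = {..<r}"
  proof -
    have "?Y = {..<card ?Y}"
    proof (rule initial_segment_nat)
      show "q' \<in> ?Y" if "q \<in> ?Y" "q' < q" for q q'
      proof -
        have q: "q < n" "q' < n" "b \<in> Q (w ! q)" using that by auto
        then have "a \<in> Q (w ! q') \<Longrightarrow> q < q'" using before [of q q'] \<open>q' < q\<close> by blast
        then have "Q (w ! q') \<noteq> {a}" "Q (w ! q') \<noteq> {a, b}" using \<open>q' < q\<close> by auto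
        then show ?thesis using all [OF mem [OF q(2)]] q(2) by blast
      qed
    qed auto
    moreover have "?I {b} \<union> ?I {a, b} = {i \<in> {1..n}. Q i = {b} \<or> Q i = {a, b}}" by auto
    ultimately show ?thesis
      using card_pos [of "\<lambda>s. Q s = {b} \<or> Q s = {a, b}"] cardB by simp
  qed
  have isb: "Q (w ! p) = {b} \<longleftrightarrow> p < r - 1" using X p by blast
  have isab: "Q (w ! p) = {b} \<or> Q (w ! p) = {a, b} \<longleftrightarrow> p < r" using Y p by blast
  consider "p < r - 1" | "p = r - 1" | "\<not> p < r" by linarith
  then show ?thesis
  proof cases
    case 1
    then show ?thesis using isb by simp
  next
    case 2
    then have "p < r" "\<not> p < r - 1" using r by auto
    then show ?thesis using isb isab 2 by simp
  next
    case 3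
    then have "Q (w ! p) = {a}" using isab all [OF mem [OF p]] by blast
    moreover have "\<not> p < r - 1" "p \<noteq> r - 1" using 3 r by auto
    ultimately show ?thesis by simp
  qed
qed

text \<open>
  Look at the midpoint \<open>x\<close> of the \<open>r\<close>-th unit segment of the edge from \<open>n w\<^sub>a\<close> to \<open>n w\<^sub>b\<close>.  Its plan only
  uses \<open>a\<close> and \<open>b\<close>, so it lives on the face \<open>Q\<close> of its cell.  By \<open>once\<close> at most one summand is
  split between \<open>a\<close> and \<open>b\<close>, and since the \<open>b\<close>-coordinate \<open>r - 1/2\<close> is not an integer, exactly one is.
\<close>

lemma edge_cell_exists:
  fixes \<F> :: "(nat \<Rightarrow> 'd::finite set) set"
  assumes n: "0 < n" and ab: "a \<noteq> b" and r: "r \<in> {1..n}"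
    and comp: "\<And>B B'. B \<in> \<F> \<Longrightarrow> B' \<in> \<F> \<Longrightarrow> compatible n B B'"
    and cover: "\<Union>(full_cells n \<F>) = dilated_simplex n"
    and once: "\<And>B i j. B \<in> \<F> \<Longrightarrow> i \<in> {1..n} \<Longrightarrow> j \<in> {1..n} \<Longrightarrow> {a, b} \<subseteq> B i \<Longrightarrow> {a, b} \<subseteq> B j \<Longrightarrow> i = j"
  shows "\<exists>F \<in> cells (full_cells n \<F>). edge_label n a b r (label n \<F> F)"
proof -
  define x :: "real ^ 'd"
    where "x = (\<chi> c. if c = b then real r - 1/2 else if c = a then real n - real r + 1/2 else 0)"
  have "x \<in> dilated_simplex n"
  proof -
    have "(\<Sum>c\<in>UNIV. x $ c) = (\<Sum>c\<in>{a, b}. x $ c)"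
      by (rule sum.mono_neutral_right) (auto simp: x_def)
    also have "\<dots> = real n" using ab by (simp add: x_def)
    finally show ?thesis using r by (auto simp: dilated_simplex_eq [OF n] x_def)
  qed
  then obtain B where B: "B \<in> \<F>" "mixed_sum n B \<in> full_cells n \<F>" "x \<in> mixed_sum n B"
    unfolding cover [symmetric] by (auto simp: full_cells_def)
  then obtain X where X: "plan n B X" "x = plan_sum n X" by (auto simp: mem_mixed_sum)
  have xs: "x $ c = (\<Sum>i\<in>{1..n}. X i c)" for c by (simp add: X(2) plan_sum_def)
  have zero: "X i c = 0" if "i \<in> {1..n}" "c \<notin> {a, b}" for i c
  proof -
    have "(\<Sum>i\<in>{1..n}. X i c) = 0" using xs [of c] that(2) by (simp add: x_def)
    then show ?thesis using X(1) that(1) by (subst (asm) sum_nonneg_eq_0_iff) (auto simp: plan_def)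
  qed
  define Q where "Q i = B i \<inter> {a, b}" for i
  have Qne: "Q i \<noteq> {}" if "i \<in> {1..n}" for i
    using plan_nonempty [OF X(1) that] zero [OF that] unfolding Q_def by fastforce
  have rows: "X i a + X i b = 1" if "i \<in> {1..n}" for i
  proof -
    have "(\<Sum>c\<in>UNIV. X i c) = (\<Sum>c\<in>{a, b}. X i c)"
      by (rule sum.mono_neutral_right) (use zero that in auto)
    then show ?thesis using X(1) that ab by (simp add: plan_def)
  qed
  let ?I = "\<lambda>s. {i \<in> {1..n}. Q i = s}"
  have all: "Q i = {b} \<or> Q i = {a, b} \<or> Q i = {a}" if "i \<in> {1..n}" for i
    using Qne [OF that] unfolding Q_def by auto
  have ne: "{a} \<noteq> {a, b}" "{b} \<noteq> {a, b}" "{a} \<noteq> {b}" using ab by auto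
  have Xb: "X i b = (if Q i = {b} then 1 else 0) + (if Q i = {a, b} then X i b else 0)"
    if "i \<in> {1..n}" for i
  proof -
    have "X i a = 0" if "Q i = {b}"
    proof -
      have "a \<notin> B i" using that ab unfolding Q_def by blast
      then show ?thesis using X(1) \<open>i \<in> {1..n}\<close> by (simp add: plan_def)
    qed
    moreover have "X i b = 0" if "Q i = {a}"
    proof -
      have "b \<notin> B i"
      proof
        assume "b \<in> B i"
        then have "b \<in> Q i" by (simp add: Q_def)
        with that ab show False by simp
      qed
      then show ?thesis using X(1) \<open>i \<in> {1..n}\<close> by (simp add: plan_def)
    qed
    ultimately show ?thesis using all [OF that] rows [OF that] ne by auto
  qed
  have "real r - 1/2 = (\<Sum>i\<in>{1..n}. X i b)" using xs [of b] by (simp add: x_def)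
  also have "\<dots> = (\<Sum>i\<in>{1..n}. (if Q i = {b} then 1 else 0) + (if Q i = {a, b} then X i b else 0))"
    using Xb by (rule sum.cong [OF refl])
  also have "\<dots> = card (?I {b}) + (\<Sum>i\<in>?I {a, b}. X i b)"
    by (simp add: sum.distrib sum.If_cases Int_def conj_commute)
  finally have half: "real r - 1/2 = card (?I {b}) + (\<Sum>i\<in>?I {a, b}. X i b)" .
  have "?I {a, b} \<noteq> {}"
  proof
    assume "?I {a, b} = {}"
    with half have "2 * real r - 1 = 2 * real (card (?I {b}))"
      by (simp only: sum.empty)
    then have "2 * int r - 1 = 2 * int (card (?I {b}))" by linarith
    then show False by presburger
  qed
  then obtain k where k: "k \<in> {1..n}" "Q k = {a, b}" by blast
  have Ik: "?I {a, b} = {k}"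
    using once [OF B(1)] k unfolding Q_def by blast
  have "0 \<le> X k b" "X k b \<le> 1"
    using X(1) k(1) rows [OF k(1)] unfolding plan_def by (auto, smt (verit))
  then have cb: "card (?I {b}) = r - 1" using half Ik r by auto
  have "?I {b} \<union> ?I {a, b} \<union> ?I {a} = {1..n}" using all by blast
  then have "card (?I {b}) + card (?I {a, b}) + card (?I {a}) = n"
    using ne by (subst card_Un_disjoint [symmetric] card_Un_disjoint [symmetric], simp, simp, force)+ simp
  then have "card (?I {a}) = n - r" using cb Ik r by simp
  then have edge: "edge_label n a b r Q" using cb Ik unfolding edge_label_def by simp
  have sub: "\<forall>i\<in>{1..n}. Q i \<subseteq> B i" by (auto simp: Q_def)
  have "mixed_sum n Q \<noteq> {}" using uniform_plan [of n Q, OF Qne] mem_mixed_sum [of _ n Q] by blast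
  then have "mixed_sum n Q \<in> cells (full_cells n \<F>)"
    using mixed_sum_face [OF comp [OF B(1) B(1)] sub] B(2) unfolding cells_def by blast
  moreover have "label n \<F> (mixed_sum n Q) i = Q i" if "i \<in> {1..n}" for i
    by (rule label_mixed_sum [OF comp B(1) sub Qne that])
  then have "edge_label n a b r (label n \<F> (mixed_sum n Q))"
    using edge unfolding edge_label_def by (simp cong: conj_cong)
  ultimately show ?thesis by blast
qed

lemma subdivision_system_label:
  fixes \<F> :: "(nat \<Rightarrow> 'd::finite set) set"
  assumes n: "0 < n" and ab: "a \<noteq> b" and w: "w \<in> permutations_of_set {1..n}"
    and comp: "\<And>B B'. B \<in> \<F> \<Longrightarrow> B' \<in> \<F> \<Longrightarrow> compatible n B B'"
    and cover: "\<Union>(full_cells n \<F>) = dilated_simplex n"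
    and ord: "\<And>B i j. B \<in> \<F> \<Longrightarrow> i \<in> {1..n} \<Longrightarrow> j \<in> {1..n} \<Longrightarrow> i \<noteq> j \<Longrightarrow>
      a \<in> B i \<Longrightarrow> b \<in> B j \<Longrightarrow> appears_before j i w"
  shows "subdivision_system n (full_cells n \<F>) (label n \<F>) a b = w"
proof -
  have w': "distinct w" "set w = {1..n}" using w by (auto simp: permutations_of_set_def)
  have len: "length w = n" using distinct_card [OF w'(1)] w'(2) by simp
  have once: "i = j" if "B \<in> \<F>" "i \<in> {1..n}" "j \<in> {1..n}" "{a, b} \<subseteq> B i" "{a, b} \<subseteq> B j" for B i j
  proof (rule ccontr)
    assume "i \<noteq> j"
    then have "appears_before j i w" "appears_before i j w"
      using ord [OF that(1-3)] ord [OF that(1,3,2)] that(4,5) by auto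
    then show False using w'(1) by (auto simp: appears_before_def nth_eq_iff_index_eq)
  qed
  let ?L = "label n \<F>" and ?S = "full_cells n \<F>"
  have word: "?L F (w ! p) = (if p < r - 1 then {b} else if p = r - 1 then {a, b} else {a})"
    if "F \<in> cells ?S" "edge_label n a b r (?L F)" "r \<in> {1..n}" "p < n" for F r p
  proof (rule edge_label_determined [OF w' ab that(3,2) _ that(4)])
    from that(1) obtain B where B: "B \<in> \<F>" "F face_of mixed_sum n B" "F \<noteq> {}"
      by (rule cells_full_cellsE)
    have sub: "?L F i \<subseteq> B i" if "i \<in> {1..n}" for i
      by (rule label_sub [OF comp B(1) _ face_of_imp_subset [OF B(2)] that]) auto
    show "appears_before j i w"
      if "i \<in> {1..n}" "j \<in> {1..n}" "i \<noteq> j" "a \<in> ?L F i" "b \<in> ?L F j" for i j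
      using ord [OF B(1) that(1-3)] that sub by blast
  qed
  have "(THE i. i \<in> {1..n} \<and> ?L (edge_cell n ?S ?L a b r) i = {a, b}) = w ! (r - 1)"
    if r: "r \<in> {1..n}" for r
  proof -
    have "\<exists>F\<in>cells ?S. edge_label n a b r (?L F)"
      by (rule edge_cell_exists [OF n ab r comp cover once])
    then obtain F where F: "F \<in> cells ?S" "edge_label n a b r (?L F)" by blast
    have "edge_cell n ?S ?L a b r = F"
      unfolding edge_cell_def
    proof (rule the_equality)
      fix G assume G: "G \<in> cells ?S \<and> edge_label n a b r (?L G)"
      have "\<forall>i\<in>{1..n}. ?L G i = ?L F i"
      proof
        fix i assume "i \<in> {1..n}"
        then obtain p where "p < n" "i = w ! p" using w'(2) len by (metis in_set_conv_nth)
        then show "?L G i = ?L F i" using word [of G r p] word [of F r p] F G r by simp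
      qed
      then have "mixed_sum n (?L G) = mixed_sum n (?L F)" by (rule mixed_sum_cong)
      then show "G = F"
        using mixed_labeling_label [OF comp] F(1) G unfolding mixed_labeling_def by metis
    qed (use F in blast)
    moreover have "(THE i. i \<in> {1..n} \<and> ?L F i = {a, b}) = w ! (r - 1)"
    proof (rule the_equality)
      have "r - 1 < n" using r by auto
      then show "w ! (r - 1) \<in> {1..n} \<and> ?L F (w ! (r - 1)) = {a, b}"
        using word [OF F r, of "r - 1"] nth_mem [of "r - 1" w] len w'(2) by auto
      fix i assume i: "i \<in> {1..n} \<and> ?L F i = {a, b}"
      then obtain p where p: "p < n" "i = w ! p" using w'(2) len by (metis in_set_conv_nth)
      have "{b} \<noteq> {a, b}" "{a} \<noteq> {a, b}" using ab by auto
      with word [OF F r p(1)] i p(2) have "p = r - 1" by (auto split: if_splits)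
      then show "i = w ! (r - 1)" using p(2) by simp
    qed
    ultimately show ?thesis by simp
  qed
  note entry = this
  show ?thesis
    unfolding subdivision_system_def
  proof (rule nth_equalityI)
    show "length (map (\<lambda>r. THE i. i \<in> {1..n} \<and> ?L (edge_cell n ?S ?L a b r) i = {a, b}) [1..<n + 1]) = length w"
      using len by simp
    fix p assume "p < length (map (\<lambda>r. THE i. i \<in> {1..n} \<and> ?L (edge_cell n ?S ?L a b r) i = {a, b}) [1..<n + 1])"
    then have p: "p < n" by (simp only: length_map length_upt)
    have e: "[1..<n + 1] ! p = Suc p" using p by (subst nth_upt) auto
    have "p < length [1..<n + 1]" using p by simp
    then show "map (\<lambda>r. THE i. i \<in> {1..n} \<and> ?L (edge_cell n ?S ?L a b r) i = {a, b}) [1..<n + 1] ! p = w ! p"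
      using entry [of "Suc p"] p by (simp only: nth_map e) simp
  qed
qed

section \<open>Three compatible orders\<close>

lemma rank_bij:
  fixes \<phi> :: "'u \<Rightarrow> nat"
  assumes U: "finite U" and inj: "inj_on \<phi> U"
  obtains f where "bij_betw f U {..<card U}"
    "\<And>u v. u \<in> U \<Longrightarrow> v \<in> U \<Longrightarrow> f u < f v \<longleftrightarrow> \<phi> u < \<phi> v"
proof -
  define f where "f u = card {v \<in> U. \<phi> v < \<phi> u}" for u
  have mono: "f u < f v" if "u \<in> U" "v \<in> U" "\<phi> u < \<phi> v" for u v
    unfolding f_def by (rule psubset_card_mono) (use U that in auto)
  have iff: "f u < f v \<longleftrightarrow> \<phi> u < \<phi> v" if "u \<in> U" "v \<in> U" for u v
    using mono [OF that] mono [OF that(2,1)] inj_onD [OF inj _ that]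
    by (metis less_asym linorder_neqE_nat less_irrefl)
  have "inj_on f U"
    by (rule inj_onI) (metis iff inj inj_onD less_irrefl linorder_neqE_nat)
  moreover have "f ` U \<subseteq> {..<card U}"
    unfolding f_def using U by (auto intro!: psubset_card_mono)
  ultimately have "bij_betw f U {..<card U}"
    unfolding bij_betw_def by (metis card_image card_lessThan card_subset_eq finite_lessThan)
  then show thesis using iff by (rule that)
qed

lemma card_initial_segment:
  assumes "bij_betw f U {..<N}" "k \<le> N"
  shows "card {u \<in> U. f u < k} = k"
proof -
  have "bij_betw f {u \<in> U. f u < k} {i \<in> {..<N}. i < k}"
    by (rule bij_betw_Collect [OF assms(1)]) simp
  moreover have "{i \<in> {..<N}. i < k} = {..<k}" using assms(2) by auto
  ultimately show ?thesis using bij_betw_same_card by fastforce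
qed

text \<open>
  A position in the plane is given by thresholds \<open>\<alpha>, \<beta>, \<gamma>\<close> for the three orders; \<open>f u < \<alpha>\<close> means that the
  position prefers sector 1 to 2 for \<open>u\<close>, \<open>g u < \<beta>\<close> that it prefers 2 to 3, and \<open>h u < \<gamma>\<close> that it
  prefers 1 to 3.  The first property of the conclusion makes the preferences transitive.  The second makes \<open>\<gamma>\<close>
  essentially the smallest value that the first one allows, except that \<open>\<gamma>\<close> may already have begun to
  rise towards the value it needs after the next rise of \<open>\<alpha>\<close> or \<open>\<beta>\<close>; without this slack, \<open>\<gamma>\<close>
  would jump and the first sector would gain several elements at once.

  Among all such positions with \<open>n2\<close> elements in sector 2 and at most \<open>n1\<close> in sector 1, take one
  with the largest sum of thresholds.  If sector 1 has fewer than \<open>n1\<close> elements, some move below raises the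
  thresholds while adding at most one element to sector 1, unless \<open>\<beta>\<close> is maximal; but then sector 3
  is empty and sector 1 has all the other elements, at least \<open>n1\<close> of them.
\<close>

lemma bij_rank_cut:
  fixes f g h :: "'u \<Rightarrow> nat"
  assumes U: "finite U"
    and f: "bij_betw f U {..<card U}" and g: "bij_betw g U {..<card U}"
    and h: "bij_betw h U {..<card U}"
    and cons: "\<And>u v. u \<in> U \<Longrightarrow> v \<in> U \<Longrightarrow> f u < f v \<Longrightarrow> g u < g v \<Longrightarrow> h u < h v"
    and n: "n1 + n2 \<le> card U"
  obtains \<alpha> \<beta> \<gamma> where
    "\<And>u. u \<in> U \<Longrightarrow> f u < \<alpha> \<Longrightarrow> g u < \<beta> \<Longrightarrow> h u < \<gamma>"
    "\<And>c. c \<in> U \<Longrightarrow> h c < \<gamma> \<Longrightarrow>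
      \<exists>e\<in>U. h c \<le> h e \<and> f e \<le> \<alpha> \<and> g e \<le> \<beta> \<and> (f e < \<alpha> \<or> g e < \<beta>)"
    "card {u \<in> U. f u < \<alpha> \<and> h u < \<gamma>} = n1"
    "card {u \<in> U. \<not> f u < \<alpha> \<and> g u < \<beta>} = n2"
proof -
  let ?N = "card U"
  define st where "st = (\<lambda>(\<alpha>, \<beta>, \<gamma>). \<alpha> \<le> ?N \<and> \<beta> \<le> ?N \<and> \<gamma> \<le> ?N \<and>
    (\<forall>u\<in>U. f u < \<alpha> \<longrightarrow> g u < \<beta> \<longrightarrow> h u < \<gamma>) \<and>
    (\<forall>c\<in>U. h c < \<gamma> \<longrightarrow>
      (\<exists>e\<in>U. h c \<le> h e \<and> f e \<le> \<alpha> \<and> g e \<le> \<beta> \<and> (f e < \<alpha> \<or> g e < \<beta>))) \<and>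
    card {u \<in> U. f u < \<alpha> \<and> h u < \<gamma>} \<le> n1 \<and>
    card {u \<in> U. \<not> f u < \<alpha> \<and> g u < \<beta>} = n2)"
  have stI: "st (\<alpha>, \<beta>, \<gamma>)"
    if "\<alpha> \<le> ?N" "\<beta> \<le> ?N" "\<gamma> \<le> ?N"
      "\<And>u. u \<in> U \<Longrightarrow> f u < \<alpha> \<Longrightarrow> g u < \<beta> \<Longrightarrow> h u < \<gamma>"
      "\<And>c. c \<in> U \<Longrightarrow> h c < \<gamma> \<Longrightarrow>
        \<exists>e\<in>U. h c \<le> h e \<and> f e \<le> \<alpha> \<and> g e \<le> \<beta> \<and> (f e < \<alpha> \<or> g e < \<beta>)"
      "card {u \<in> U. f u < \<alpha> \<and> h u < \<gamma>} \<le> n1"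
      "card {u \<in> U. \<not> f u < \<alpha> \<and> g u < \<beta>} = n2" for \<alpha> \<beta> \<gamma>
    using that unfolding st_def by blast
  have "st (0, n2, 0)"
    using n card_initial_segment [OF g, of n2] by (simp add: st_def)
  moreover have "\<forall>s. st s \<longrightarrow> (case s of (\<alpha>, \<beta>, \<gamma>) \<Rightarrow> \<alpha> + \<beta> + \<gamma>) < Suc (3 * ?N)"
    by (auto simp: st_def)
  ultimately obtain s where s: "st s"
    and max': "\<And>t. st t \<Longrightarrow> (case t of (\<alpha>, \<beta>, \<gamma>) \<Rightarrow> \<alpha> + \<beta> + \<gamma>) \<le> (case s of (\<alpha>, \<beta>, \<gamma>) \<Rightarrow> \<alpha> + \<beta> + \<gamma>)"
    using ex_has_greatest_nat [of st "(0, n2, 0)" "\<lambda>(\<alpha>, \<beta>, \<gamma>). \<alpha> + \<beta> + \<gamma>" "Suc (3 * ?N)"] by blast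
  obtain \<alpha> \<beta> \<gamma> where s_eq: "s = (\<alpha>, \<beta>, \<gamma>)" by (cases s)
  have max: "\<not> st (\<alpha>', \<beta>', \<gamma>')" if "\<alpha> + \<beta> + \<gamma> < \<alpha>' + \<beta>' + \<gamma>'" for \<alpha>' \<beta>' \<gamma>'
    using max' [of "(\<alpha>', \<beta>', \<gamma>')"] that s_eq by auto
  have bounds: "\<alpha> \<le> ?N" "\<beta> \<le> ?N" "\<gamma> \<le> ?N"
    and S1: "\<And>u. u \<in> U \<Longrightarrow> f u < \<alpha> \<Longrightarrow> g u < \<beta> \<Longrightarrow> h u < \<gamma>"
    and S2: "\<And>c. c \<in> U \<Longrightarrow> h c < \<gamma> \<Longrightarrow>
      \<exists>e\<in>U. h c \<le> h e \<and> f e \<le> \<alpha> \<and> g e \<le> \<beta> \<and> (f e < \<alpha> \<or> g e < \<beta>)"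
    and c1: "card {u \<in> U. f u < \<alpha> \<and> h u < \<gamma>} \<le> n1"
    and c2: "card {u \<in> U. \<not> f u < \<alpha> \<and> g u < \<beta>} = n2"
    using s unfolding s_eq st_def by auto
  have at: "\<exists>u\<in>U. k u = i" if "bij_betw k U {..<?N}" "i < ?N" for k :: "'u \<Rightarrow> nat" and i
    using that unfolding bij_betw_def by (metis imageE lessThan_iff)
  have eqD: "u = v" if "k u = k v" "u \<in> U" "v \<in> U" "bij_betw k U {..<?N}" for k :: "'u \<Rightarrow> nat" and u v
    using that by (meson bij_betw_imp_inj_on inj_onD)
  have lt: "k u < ?N" if "u \<in> U" "bij_betw k U {..<?N}" for k :: "'u \<Rightarrow> nat" and u
    using that bij_betwE by blast
  have "\<not> card {u \<in> U. f u < \<alpha> \<and> h u < \<gamma>} < n1"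
  proof
    assume less: "card {u \<in> U. f u < \<alpha> \<and> h u < \<gamma>} < n1"
    \<comment> \<open>maximality: \<open>\<gamma>\<close> has passed everything that the next rise of \<open>\<alpha>\<close> or \<open>\<beta>\<close> demands\<close>
    have raise_\<gamma>: "h e < \<gamma>"
      if e: "e \<in> U" "f e \<le> \<alpha>" "g e \<le> \<beta>" "f e < \<alpha> \<or> g e < \<beta>" for e
    proof (rule ccontr)
      assume "\<not> h e < \<gamma>"
      then have "\<gamma> < ?N" using lt [OF e(1) h] by simp
      then obtain c where c: "c \<in> U" "h c = \<gamma>" using at [OF h] by blast
      have "{u \<in> U. f u < \<alpha> \<and> h u < Suc \<gamma>} \<subseteq> insert c {u \<in> U. f u < \<alpha> \<and> h u < \<gamma>}"
        using c eqD [OF _ _ _ h] by (auto simp: less_Suc_eq)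
      then have "card {u \<in> U. f u < \<alpha> \<and> h u < Suc \<gamma>} \<le> card (insert c {u \<in> U. f u < \<alpha> \<and> h u < \<gamma>})"
        using U by (intro card_mono) auto
      also have "\<dots> \<le> Suc (card {u \<in> U. f u < \<alpha> \<and> h u < \<gamma>})" by (rule card_insert_le_m1) auto
      finally have "card {u \<in> U. f u < \<alpha> \<and> h u < Suc \<gamma>} \<le> n1" using less by simp
      moreover have "\<exists>e\<in>U. h c \<le> h e \<and> f e \<le> \<alpha> \<and> g e \<le> \<beta> \<and> (f e < \<alpha> \<or> g e < \<beta>)"
        if "c \<in> U" "h c < Suc \<gamma>" for c
      proof (cases "h c < \<gamma>")
        case True
        with S2 that show ?thesis by blast
      next
        case False
        then have "h c \<le> h e" using that \<open>\<not> h e < \<gamma>\<close> by simp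
        with e show ?thesis by blast
      qed
      ultimately have "st (\<alpha>, \<beta>, Suc \<gamma>)"
        using bounds \<open>\<gamma> < ?N\<close> S1 c2 by (intro stI) (simp_all add: less_SucI)
      then show False using max by simp
    qed
    show False
    proof (cases "\<beta> < ?N")
      case True
      then obtain b where b: "b \<in> U" "g b = \<beta>" using at [OF g] by blast
      have gS: "g u < Suc \<beta> \<longleftrightarrow> g u < \<beta> \<or> u = b" if "u \<in> U" for u
        using eqD [OF _ that b(1) g] b(2) by (auto simp: less_Suc_eq)
      show False
      proof (cases "f b < \<alpha>")
        \<comment> \<open>raising \<open>\<beta>\<close> past \<open>b\<close> changes no sector: \<open>b\<close> is in sector 1 already\<close>
        case fb: True
        then have "h b < \<gamma>" using raise_\<gamma> [OF b(1)] b(2) by simp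
        have "{u \<in> U. \<not> f u < \<alpha> \<and> g u < Suc \<beta>} = {u \<in> U. \<not> f u < \<alpha> \<and> g u < \<beta>}"
          using gS fb by auto
        moreover have "h u < \<gamma>" if "u \<in> U" "f u < \<alpha>" "g u < Suc \<beta>" for u
          using S1 [OF that(1)] gS [OF that(1)] that \<open>h b < \<gamma>\<close> by auto
        moreover have "\<exists>e\<in>U. h c \<le> h e \<and> f e \<le> \<alpha> \<and> g e \<le> Suc \<beta> \<and> (f e < \<alpha> \<or> g e < Suc \<beta>)"
          if "c \<in> U" "h c < \<gamma>" for c
          using S2 [OF that] by (meson le_SucI less_SucI)
        ultimately have "st (\<alpha>, Suc \<beta>, \<gamma>)"
          using bounds True c1 c2 by (intro stI) simp_all
        then show False using max by simp
      next
        case fb: False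
        then have "\<alpha> < ?N" using lt [OF b(1) f] by simp
        then obtain a where a: "a \<in> U" "f a = \<alpha>" using at [OF f] by blast
        have fS: "f u < Suc \<alpha> \<longleftrightarrow> f u < \<alpha> \<or> u = a" if "u \<in> U" for u
          using eqD [OF _ that a(1) f] a(2) by (auto simp: less_Suc_eq)
        show False
        proof (cases "g a < \<beta>")
          \<comment> \<open>raising \<open>\<alpha>\<close> past \<open>a\<close> changes no sector: \<open>a\<close> stays in sector 3\<close>
          case ga: False
          have ha: "\<not> h a < \<gamma>"
          proof
            assume "h a < \<gamma>"
            then obtain e where e: "e \<in> U" "h a \<le> h e" "f e \<le> \<alpha>" "g e \<le> \<beta>" "f e < \<alpha> \<or> g e < \<beta>"
              using S2 a(1) by blast
            have "e \<noteq> a" using e(5) a(2) ga by auto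
            then have "f e < f a" "g e < g a"
              using eqD [OF _ e(1) a(1) f] eqD [OF _ e(1) a(1) g] e(3,4) a(2) ga by force+
            from cons [OF e(1) a(1) this] e(2) show False by simp
          qed
          have "{u \<in> U. \<not> f u < Suc \<alpha> \<and> g u < \<beta>} = {u \<in> U. \<not> f u < \<alpha> \<and> g u < \<beta>}"
            using fS ga by auto
          moreover have "{u \<in> U. f u < Suc \<alpha> \<and> h u < \<gamma>} = {u \<in> U. f u < \<alpha> \<and> h u < \<gamma>}"
            using fS ha by auto
          moreover have "h u < \<gamma>" if "u \<in> U" "f u < Suc \<alpha>" "g u < \<beta>" for u
            using S1 [OF that(1)] fS [OF that(1)] that ga by auto
          moreover have "\<exists>e\<in>U. h c \<le> h e \<and> f e \<le> Suc \<alpha> \<and> g e \<le> \<beta> \<and> (f e < Suc \<alpha> \<or> g e < \<beta>)"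
            if "c \<in> U" "h c < \<gamma>" for c
            using S2 [OF that] by (meson le_SucI less_SucI)
          ultimately have "st (Suc \<alpha>, \<beta>, \<gamma>)"
            using bounds \<open>\<alpha> < ?N\<close> c1 c2 by (intro stI) simp_all
          then show False using max by simp
        next
          \<comment> \<open>raising both moves \<open>a\<close> from sector 2 to 1 and \<open>b\<close> from sector 3 to 2\<close>
          case ga: True
          have "a \<noteq> b" using ga b(2) by auto
          have "h a < \<gamma>" using raise_\<gamma> [OF a(1)] a(2) ga by simp
          have "{u \<in> U. \<not> f u < Suc \<alpha> \<and> g u < Suc \<beta>} = insert b ({u \<in> U. \<not> f u < \<alpha> \<and> g u < \<beta>} - {a})"
            using fS gS fb \<open>a \<noteq> b\<close> b(1) by auto
          moreover have "card (insert b ({u \<in> U. \<not> f u < \<alpha> \<and> g u < \<beta>} - {a})) = n2"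
          proof -
            have "card {u \<in> U. \<not> f u < \<alpha> \<and> g u < \<beta>} = Suc (card ({u \<in> U. \<not> f u < \<alpha> \<and> g u < \<beta>} - {a}))"
              by (rule card.remove) (use U a ga in auto)
            moreover have "b \<notin> {u \<in> U. \<not> f u < \<alpha> \<and> g u < \<beta>} - {a}" using b(2) by simp
            moreover have "finite ({u \<in> U. \<not> f u < \<alpha> \<and> g u < \<beta>} - {a})" using U by simp
            ultimately show ?thesis using c2 by (metis card_insert_disjoint)
          qed
          moreover have "card {u \<in> U. f u < Suc \<alpha> \<and> h u < \<gamma>} \<le> n1"
          proof -
            have "{u \<in> U. f u < Suc \<alpha> \<and> h u < \<gamma>} \<subseteq> insert a {u \<in> U. f u < \<alpha> \<and> h u < \<gamma>}"
              using fS by auto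
            then have "card {u \<in> U. f u < Suc \<alpha> \<and> h u < \<gamma>} \<le> card (insert a {u \<in> U. f u < \<alpha> \<and> h u < \<gamma>})"
              using U by (intro card_mono) auto
            also have "\<dots> \<le> Suc (card {u \<in> U. f u < \<alpha> \<and> h u < \<gamma>})" by (rule card_insert_le_m1) auto
            finally show ?thesis using less by simp
          qed
          moreover have "h u < \<gamma>" if "u \<in> U" "f u < Suc \<alpha>" "g u < Suc \<beta>" for u
            using S1 [OF that(1)] fS [OF that(1)] gS [OF that(1)] that \<open>h a < \<gamma>\<close> fb \<open>a \<noteq> b\<close> by auto
          moreover have "\<exists>e\<in>U. h c \<le> h e \<and> f e \<le> Suc \<alpha> \<and> g e \<le> Suc \<beta> \<and> (f e < Suc \<alpha> \<or> g e < Suc \<beta>)"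
            if "c \<in> U" "h c < \<gamma>" for c
            using S2 [OF that] by (meson le_SucI less_SucI)
          ultimately have "st (Suc \<alpha>, Suc \<beta>, \<gamma>)"
            using bounds \<open>\<alpha> < ?N\<close> True by (intro stI) simp_all
          then show False using max by simp
        qed
      qed
    next
      case False
      then have "\<beta> = ?N" using bounds by simp
      then have gB: "g u < \<beta>" if "u \<in> U" for u using lt [OF that g] by simp
      have "{u \<in> U. \<not> f u < \<alpha> \<and> g u < \<beta>} = U - {u \<in> U. f u < \<alpha>}" using gB by auto
      then have "n2 = ?N - \<alpha>"
        using c2 U card_initial_segment [OF f bounds(1)] by (simp add: card_Diff_subset)
      moreover have "{u \<in> U. f u < \<alpha> \<and> h u < \<gamma>} = {u \<in> U. f u < \<alpha>}" using S1 gB by auto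
      ultimately show False using less card_initial_segment [OF f bounds(1)] n bounds by simp
    qed
  qed
  with c1 have "card {u \<in> U. f u < \<alpha> \<and> h u < \<gamma>} = n1" by simp
  from that [OF S1 S2 this c2] show thesis .
qed

text \<open>
  The sectors of the position found in \<open>bij_rank_cut\<close>, described without reference to the
  thresholds.  The last two properties express that the legs \<open>13\<close> follow the canonical routing.  The bounds on \<open>e\<close> in
  the last one are not strict, because \<open>e\<close> may be an element that the slack in \<open>\<gamma>\<close> anticipates.
\<close>

lemma three_order_partition:
  fixes f g h :: "'u \<Rightarrow> nat"
  assumes U: "finite U"
    and inj: "inj_on f U" "inj_on g U" "inj_on h U"
    and cons: "\<And>u v. u \<in> U \<Longrightarrow> v \<in> U \<Longrightarrow> f u < f v \<Longrightarrow> g u < g v \<Longrightarrow> h u < h v"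
    and n: "card U = n1 + n2 + n3"
  obtains P Q R where
    "P \<union> Q \<union> R = U" "P \<inter> Q = {}" "P \<inter> R = {}" "Q \<inter> R = {}"
    "card P = n1" "card Q = n2" "card R = n3"
    "\<And>u v. u \<in> P \<Longrightarrow> v \<in> Q \<Longrightarrow> f u < f v"
    "\<And>v w. v \<in> Q \<Longrightarrow> w \<in> R \<Longrightarrow> g v < g w"
    "\<And>u w. u \<in> P \<Longrightarrow> w \<in> R \<Longrightarrow> h u < h w"
    "\<And>u v w e. u \<in> P \<Longrightarrow> v \<in> Q \<Longrightarrow> w \<in> R \<Longrightarrow> e \<in> U \<Longrightarrow> f e < f u \<Longrightarrow> g e < g v \<Longrightarrow> h e < h w"
    "\<And>u v w. u \<in> P \<Longrightarrow> v \<in> Q \<Longrightarrow> w \<in> R \<Longrightarrow> \<exists>e\<in>U. h u \<le> h e \<and> f e \<le> f v \<and> g e \<le> g w"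
proof -
  obtain f' where f': "bij_betw f' U {..<card U}"
    and f: "\<And>u v. u \<in> U \<Longrightarrow> v \<in> U \<Longrightarrow> f' u < f' v \<longleftrightarrow> f u < f v"
    using rank_bij [OF U inj(1)] by blast
  obtain g' where g': "bij_betw g' U {..<card U}"
    and g: "\<And>u v. u \<in> U \<Longrightarrow> v \<in> U \<Longrightarrow> g' u < g' v \<longleftrightarrow> g u < g v"
    using rank_bij [OF U inj(2)] by blast
  obtain h' where h': "bij_betw h' U {..<card U}"
    and h: "\<And>u v. u \<in> U \<Longrightarrow> v \<in> U \<Longrightarrow> h' u < h' v \<longleftrightarrow> h u < h v"
    using rank_bij [OF U inj(3)] by blast
  have cons': "h' u < h' v" if "u \<in> U" "v \<in> U" "f' u < f' v" "g' u < g' v" for u v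
    using cons that f g h by simp
  have "n1 + n2 \<le> card U" using n by simp
  then obtain \<alpha> \<beta> \<gamma> where
    S1: "\<And>u. u \<in> U \<Longrightarrow> f' u < \<alpha> \<Longrightarrow> g' u < \<beta> \<Longrightarrow> h' u < \<gamma>"
    and S2: "\<And>c. c \<in> U \<Longrightarrow> h' c < \<gamma> \<Longrightarrow>
      \<exists>e\<in>U. h' c \<le> h' e \<and> f' e \<le> \<alpha> \<and> g' e \<le> \<beta> \<and> (f' e < \<alpha> \<or> g' e < \<beta>)"
    and c1: "card {u \<in> U. f' u < \<alpha> \<and> h' u < \<gamma>} = n1"
    and c2: "card {u \<in> U. \<not> f' u < \<alpha> \<and> g' u < \<beta>} = n2"
    using bij_rank_cut [OF U f' g' h' cons'] by blast
  define P where "P = {u \<in> U. f' u < \<alpha> \<and> h' u < \<gamma>}"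
  define Q where "Q = {u \<in> U. \<not> f' u < \<alpha> \<and> g' u < \<beta>}"
  define R where "R = U - P - Q"
  have sub: "P \<subseteq> U" "Q \<subseteq> U" "R \<subseteq> U" by (auto simp: P_def Q_def R_def)
  have disj: "P \<inter> Q = {}" "P \<inter> R = {}" "Q \<inter> R = {}" by (auto simp: P_def Q_def R_def)
  have RD: "\<not> g' w < \<beta>" "\<not> h' w < \<gamma>" if "w \<in> R" for w
  proof -
    have w: "w \<in> U" "\<not> (f' w < \<alpha> \<and> h' w < \<gamma>)" "\<not> (\<not> f' w < \<alpha> \<and> g' w < \<beta>)"
      using that by (auto simp: P_def Q_def R_def)
    show gw: "\<not> g' w < \<beta>" using w S1 by blast
    show "\<not> h' w < \<gamma>"
    proof
      assume hw: "h' w < \<gamma>"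
      with w have fw: "\<not> f' w < \<alpha>" by blast
      obtain e where e: "e \<in> U" "h' w \<le> h' e" "f' e \<le> \<alpha>" "g' e \<le> \<beta>" "f' e < \<alpha> \<or> g' e < \<beta>"
        using S2 [OF w(1) hw] by blast
      have "e \<noteq> w" using e(5) fw gw by auto
      then have "f' e \<noteq> f' w" "g' e \<noteq> g' w"
        using e(1) w(1) f' g' by (meson bij_betw_imp_inj_on inj_onD)+
      then have "h' e < h' w" using e fw gw by (intro cons' e w) auto
      with e(2) show False by simp
    qed
  qed
  show thesis
  proof (rule that [of P Q R])
    show "P \<union> Q \<union> R = U" using sub by (auto simp: R_def)
    show "P \<inter> Q = {}" "P \<inter> R = {}" "Q \<inter> R = {}" by (fact disj)+
    show "card P = n1" "card Q = n2" using c1 c2 by (simp_all add: P_def Q_def)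
    moreover have "finite P" "finite Q" "finite R" using sub U finite_subset by blast+
    then have "card (P \<union> Q \<union> R) = card P + card Q + card R"
      using disj by (simp add: card_Un_disjoint Int_Un_distrib2)
    moreover have "P \<union> Q \<union> R = U" using sub by (auto simp: R_def)
    ultimately show "card R = n3" using n by simp
    show "f u < f v" if "u \<in> P" "v \<in> Q" for u v
      using that f [of u v] by (auto simp: P_def Q_def)
    show "g v < g w" if "v \<in> Q" "w \<in> R" for v w
    proof -
      have "g' v < g' w" using that(1) RD(1) [OF that(2)] by (auto simp: Q_def)
      then show ?thesis using g that sub by blast
    qed
    show "h u < h w" if "u \<in> P" "w \<in> R" for u w
    proof -
      have "h' u < h' w" using that(1) RD(2) [OF that(2)] by (auto simp: P_def)
      then show ?thesis using h that sub by blast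
    qed
    show "h e < h w" if "u \<in> P" "v \<in> Q" "w \<in> R" "e \<in> U" "f e < f u" "g e < g v" for u v w e
    proof -
      have "f' e < f' u" "g' e < g' v" using that f g sub by blast+
      then have "h' e < \<gamma>" using that(1,2) by (intro S1 that(4)) (auto simp: P_def Q_def)
      then have "h' e < h' w" using RD(2) [OF that(3)] by simp
      then show ?thesis using h that sub by blast
    qed
    show "\<exists>e\<in>U. h u \<le> h e \<and> f e \<le> f v \<and> g e \<le> g w" if "u \<in> P" "v \<in> Q" "w \<in> R" for u v w
    proof -
      have uvw: "u \<in> U" "v \<in> U" "w \<in> U" using that sub by auto
      have "h' u < \<gamma>" using that(1) by (simp add: P_def)
      then obtain e where e: "e \<in> U" "h' u \<le> h' e" "f' e \<le> \<alpha>" "g' e \<le> \<beta>"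
        using S2 [OF uvw(1)] by blast
      have "\<not> h' e < h' u" "\<not> f' v < f' e" "\<not> g' w < g' e"
        using e that(2) RD(1) [OF that(3)] by (auto simp: Q_def)
      then have "\<not> h e < h u" "\<not> f v < f e" "\<not> g w < g e"
        using f g h e(1) uvw by blast+
      then show ?thesis using e(1) by (auto simp: not_less)
    qed
  qed
qed

lemma acyclic_total_rank:
  fixes r :: "('d::finite \<times> 'd) set"
  assumes "acyclic r" and total: "\<And>a b. a \<noteq> b \<Longrightarrow> (a, b) \<in> r \<or> (b, a) \<in> r"
  obtains f :: "'d \<Rightarrow> nat" where "inj f" "\<And>a b. f a < f b \<longleftrightarrow> (a, b) \<in> r"
proof -
  define f where "f a = card {c. (c, a) \<in> r\<^sup>+}" for a
  have irr: "(a, a) \<notin> r\<^sup>+" for a using assms(1) by (simp add: acyclic_def)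
  have mono: "f a < f b" if "(a, b) \<in> r" for a b
    unfolding f_def
  proof (rule psubset_card_mono)
    show "{c. (c, a) \<in> r\<^sup>+} \<subset> {c. (c, b) \<in> r\<^sup>+}"
      using that irr by (auto intro: trancl_into_trancl)
  qed simp
  have "f a \<noteq> f b" if "a \<noteq> b" for a b using total [OF that] mono by force
  then have "inj f" by (auto simp: inj_def)
  moreover have "f a < f b \<longleftrightarrow> (a, b) \<in> r" for a b
    using mono total [of a b] by (metis less_asym less_irrefl)
  ultimately show thesis by (rule that)
qed

section \<open>The cells of an acyclic system on three letters\<close>

text \<open>
  The first three conditions keep the crossing pattern of any two tripods.  The last two concern a position
  in sector 1 of one tripod, 2 of another and 3 of a third.  In the first of them the position lies
  below the leg \<open>13\<close> of \<open>c\<close>, so it is in the upper left quadrant of no apex \<open>e\<close> with \<open>h c \<le> h e\<close>; in the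
  second it lies above that leg, so there has to be such an \<open>e\<close>.  The premises of the last condition
  hold whenever the orders alone would permit both situations for the same triple.
\<close>

definition cell_family :: "('d \<Rightarrow> nat) \<Rightarrow> ('d \<Rightarrow> nat) \<Rightarrow> ('d \<Rightarrow> nat) \<Rightarrow> (nat \<Rightarrow> 'd::finite set) set" where
  "cell_family f g h = {B.
     (\<forall>a\<in>B 1. \<forall>b\<in>B 2. a \<noteq> b \<longrightarrow> f a < f b) \<and>
     (\<forall>b\<in>B 2. \<forall>c\<in>B 3. b \<noteq> c \<longrightarrow> g b < g c) \<and>
     (\<forall>a\<in>B 1. \<forall>c\<in>B 3. a \<noteq> c \<longrightarrow> h a < h c) \<and>
     (\<forall>a\<in>B 1. \<forall>b\<in>B 2. \<forall>c\<in>B 3. \<forall>e. f e < f a \<longrightarrow> g e < g b \<longrightarrow> h e < h c) \<and>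
     (\<forall>c\<in>B 1. \<forall>a\<in>B 2. \<forall>b\<in>B 3. f a < f b \<longrightarrow> h a < h c \<longrightarrow>
        (\<exists>e. f e < f a \<and> g e < g b \<and> h c \<le> h e))}"

lemma cell_familyD:
  assumes "B \<in> cell_family f g h"
  shows "a \<in> B 1 \<Longrightarrow> b \<in> B 2 \<Longrightarrow> a \<noteq> b \<Longrightarrow> f a < f b"
    and "a \<in> B 2 \<Longrightarrow> b \<in> B 3 \<Longrightarrow> a \<noteq> b \<Longrightarrow> g a < g b"
    and "a \<in> B 1 \<Longrightarrow> b \<in> B 3 \<Longrightarrow> a \<noteq> b \<Longrightarrow> h a < h b"
    and "a \<in> B 1 \<Longrightarrow> b \<in> B 2 \<Longrightarrow> c \<in> B 3 \<Longrightarrow> f e < f a \<Longrightarrow> g e < g b \<Longrightarrow> h e < h c"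
    and "a \<in> B 2 \<Longrightarrow> b \<in> B 3 \<Longrightarrow> c \<in> B 1 \<Longrightarrow> f a < f b \<Longrightarrow> h a < h c \<Longrightarrow>
      \<exists>e. f e < f a \<and> g e < g b \<and> h c \<le> h e"
  using assms unfolding cell_family_def by blast+

lemma atLeastAtMost_1_3: "{1..3::nat} = {1, 2, 3}"
  by auto

text \<open>
  Write an arc \<open>i \<rightarrow> j\<close> if \<open>D\<close> is positive at \<open>(i, a)\<close> and negative at \<open>(j, a)\<close> for some \<open>a\<close>.  A row
  with a nonzero entry has an outgoing arc to another such row, so a nonzero \<open>D\<close> has a directed
  cycle on three rows.  A cycle of length 2 reverses one of the orders between two vertices.  A
  cycle of length 3 gives the two graphs opposite choices at one triple: the last condition on one
  graph yields an \<open>e\<close> which the fourth condition on the other forbids.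
\<close>

lemma cell_family_compatible:
  assumes B: "B \<in> cell_family f g h" and B': "B' \<in> cell_family f g h"
  shows "compatible 3 B B'"
  unfolding compatible_def
proof (intro allI impI)
  fix D :: "nat \<Rightarrow> 'a \<Rightarrow> real"
  assume row: "\<forall>i\<in>{1..3}. (\<Sum>a\<in>UNIV. D i a) = 0"
    and col: "\<forall>a. (\<Sum>i\<in>{1..3}. D i a) = 0"
    and sgn: "\<forall>i\<in>{1..3}. \<forall>a. (0 < D i a \<longrightarrow> a \<in> B i) \<and> (D i a < 0 \<longrightarrow> a \<in> B' i)"
  define arc where "arc i j \<longleftrightarrow> (\<exists>a. 0 < D i a \<and> D j a < 0)" for i j
  define live where "live i \<longleftrightarrow> (\<exists>a. D i a \<noteq> 0)" for i
  have D3: "D 1 a + D 2 a + D 3 a = 0" for a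
    using col [unfolded atLeastAtMost_1_3] by (simp add: add.assoc)
  have out: "\<exists>j\<in>{1, 2, 3} - {i}. arc i j" if i: "live i" "i \<in> {1, 2, 3}" for i
  proof -
    obtain a where a: "D i a \<noteq> 0" using i(1) by (auto simp: live_def)
    have "\<exists>b. 0 < D i b"
    proof (rule ccontr)
      assume "\<not> ?thesis"
      then have "\<forall>b\<in>UNIV. 0 \<le> - D i b" by (simp add: not_less)
      moreover have "(\<Sum>b\<in>UNIV. - D i b) = 0" using row i(2) by (auto simp: sum_negf)
      ultimately have "D i a = 0" by (subst (asm) sum_nonneg_eq_0_iff) auto
      with a show False by simp
    qed
    then obtain b where b: "0 < D i b" by blast
    have "\<exists>j\<in>{1, 2, 3} - {i}. D j b < 0"
    proof (rule ccontr)
      assume none: "\<not> ?thesis"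
      have nonneg: "0 \<le> D j b" if "j \<noteq> i" "j \<in> {1, 2, 3}" for j
        using none that by (meson DiffI linorder_not_less singletonD)
      consider "i = 1" | "i = 2" | "i = 3" using i(2) by blast
      then show False
        using D3 [of b] b nonneg [of 1] nonneg [of 2] nonneg [of 3] by cases auto
    qed
    with b show ?thesis by (auto simp: arc_def)
  qed
  have live: "live j" if "arc i j" for i j using that unfolding arc_def live_def by (metis less_irrefl)
  have PB: "a \<in> B i" if "0 < D i a" "i \<in> {1, 2, 3}" for i a
    using sgn that by (auto simp: atLeastAtMost_1_3)
  have NB: "a \<in> B' i" if "D i a < 0" "i \<in> {1, 2, 3}" for i a
    using sgn that by (auto simp: atLeastAtMost_1_3)
  have ords: "(a \<in> A 1 \<longrightarrow> b \<in> A 2 \<longrightarrow> a \<noteq> b \<longrightarrow> f a < f b) \<and>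
      (a \<in> A 2 \<longrightarrow> b \<in> A 3 \<longrightarrow> a \<noteq> b \<longrightarrow> g a < g b) \<and>
      (a \<in> A 1 \<longrightarrow> b \<in> A 3 \<longrightarrow> a \<noteq> b \<longrightarrow> h a < h b)" if "A \<in> {B, B'}" for A a b
    using that B B' unfolding cell_family_def by auto
  have two: "\<not> (arc i j \<and> arc j i)" if "(i, j) \<in> {(1, 2), (2, 3), (1, 3)}" for i j
  proof
    assume "arc i j \<and> arc j i"
    then obtain a b where ab: "0 < D i a" "D j a < 0" "0 < D j b" "D i b < 0"
      unfolding arc_def by blast
    have "a \<noteq> b" using ab by auto
    moreover have "a \<in> B i" "b \<in> B j" "a \<in> B' j" "b \<in> B' i" using ab PB NB that by auto
    ultimately show False
      using that ords [of B a b] ords [of B' b a] by (auto dest: less_asym)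
  qed
  have cycle: False
    if A: "A \<in> cell_family f g h" "A' \<in> cell_family f g h"
      and mem: "a \<in> A 1" "b \<in> A 2" "c \<in> A 3" "a \<in> A' 2" "b \<in> A' 3" "c \<in> A' 1"
      and ne: "a \<noteq> b" "a \<noteq> c" for A A' a b c
  proof -
    have "f a < f b" "h a < h c" using cell_familyD(1,3) [OF A(1)] mem(1-3) ne by blast+
    then obtain e where e: "f e < f a" "g e < g b" "h c \<le> h e"
      using cell_familyD(5) [OF A(2) mem(4-6)] by blast
    then have "h e < h c" using cell_familyD(4) [OF A(1) mem(1-3)] by blast
    with e(3) show False by simp
  qed
  have three: "\<not> (arc 1 2 \<and> arc 2 3 \<and> arc 3 1)"
  proof
    assume "arc 1 2 \<and> arc 2 3 \<and> arc 3 1"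
    then obtain a b c where abc: "0 < D 1 a" "D 2 a < 0" "0 < D 2 b" "D 3 b < 0" "0 < D 3 c" "D 1 c < 0"
      unfolding arc_def by blast
    show False by (rule cycle [OF B B', of a b c]) (use abc PB NB in auto)
  qed
  have three': "\<not> (arc 1 3 \<and> arc 3 2 \<and> arc 2 1)"
  proof
    assume "arc 1 3 \<and> arc 3 2 \<and> arc 2 1"
    then obtain a b c where abc: "0 < D 1 c" "D 3 c < 0" "0 < D 3 b" "D 2 b < 0" "0 < D 2 a" "D 1 a < 0"
      unfolding arc_def by blast
    show False by (rule cycle [OF B' B, of a b c]) (use abc PB NB in auto)
  qed
  have "\<not> live i" if "i \<in> {1, 2, 3}" for i
    using out [of 1] out [of 2] out [of 3] live two [of 1 2] two [of 2 3] two [of 1 3] three three' that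
    by (auto; metis)
  then show "\<forall>i\<in>{1..3}. \<forall>a. D i a = 0"
    unfolding atLeastAtMost_1_3 live_def by blast
qed

text \<open>
  Split vertex \<open>a\<close> into \<open>m a\<close> copies, which are consecutive in each of the three orders (\<open>key\<close>), and
  partition the copies into three sectors of size \<open>M\<close>.  The graph joins \<open>i\<close> to the vertices with a copy
  in sector \<open>i\<close>, and the plan counts these copies.
\<close>

lemma cell_family_cover:
  fixes f g h :: "'d::finite \<Rightarrow> nat" and m :: "'d \<Rightarrow> nat"
  assumes inj: "inj f" "inj g" "inj h"
    and cons: "\<And>a b. f a < f b \<Longrightarrow> g a < g b \<Longrightarrow> h a < h b"
    and pos: "\<And>a. 0 < m a" and M: "(\<Sum>a\<in>UNIV. m a) = 3 * M"
  shows "\<exists>B\<in>cell_family f g h. (\<chi> a. real (m a) / real M) \<in> mixed_sum 3 B"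
proof -
  define U where "U = Sigma UNIV (\<lambda>a. {..<m a})"
  define key where "key k u = k (fst u) * (3 * M) + snd u" for k :: "'d \<Rightarrow> nat" and u
  have fin: "finite U" by (simp add: U_def)
  have cardU: "card U = M + M + M" using M by (simp add: U_def)
  have bound: "j < 3 * M" if "(a, j) \<in> U" for a j
  proof -
    have "m a \<le> (\<Sum>a\<in>UNIV. m a)" by (rule member_le_sum) auto
    with that M show ?thesis by (simp add: U_def)
  qed
  have key_less: "key k (a, i) < key k (b, j) \<longleftrightarrow> k a < k b \<or> (a = b \<and> i < j)"
    if "inj k" "(a, i) \<in> U" "(b, j) \<in> U" for k a b i j
  proof -
    have less: "key k (a, i) < key k (b, j)" if "k a < k b" "(a, i) \<in> U" for a b i j
    proof -
      have "key k (a, i) < Suc (k a) * (3 * M)" using bound [OF that(2)] by (simp add: key_def)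
      also have "\<dots> \<le> k b * (3 * M)" using that(1) by (intro mult_le_mono1) simp
      finally show ?thesis by (simp add: key_def)
    qed
    show ?thesis
      using less [of a b i j] less [of b a j i] that injD [OF that(1), of a b]
      by (cases "k a" "k b" rule: linorder_cases) (auto simp: key_def)
  qed
  have key_inj: "inj_on (key k) U" if "inj k" for k
  proof (rule inj_onI)
    fix u v assume uv: "u \<in> U" "v \<in> U" "key k u = key k v"
    obtain a i b j where e: "u = (a, i)" "v = (b, j)" by (cases u, cases v)
    have "\<not> (k a < k b \<or> (a = b \<and> i < j))" "\<not> (k b < k a \<or> (b = a \<and> j < i))"
      using key_less [OF that, of a i b j] key_less [OF that, of b j a i] uv e by auto
    then show "u = v" using injD [OF that, of a b] e by auto
  qed
  have key_cons: "key h u < key h v" if "u \<in> U" "v \<in> U" "key f u < key f v" "key g u < key g v" for u v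
    using that cons key_less [OF inj(1)] key_less [OF inj(2)] key_less [OF inj(3)]
    by (cases u; cases v) auto
  obtain P Q R where PQR: "P \<union> Q \<union> R = U" "P \<inter> Q = {}" "P \<inter> R = {}" "Q \<inter> R = {}"
    "card P = M" "card Q = M" "card R = M"
    and PQ: "\<And>u v. u \<in> P \<Longrightarrow> v \<in> Q \<Longrightarrow> key f u < key f v"
    and QR: "\<And>v w. v \<in> Q \<Longrightarrow> w \<in> R \<Longrightarrow> key g v < key g w"
    and PR: "\<And>u w. u \<in> P \<Longrightarrow> w \<in> R \<Longrightarrow> key h u < key h w"
    and out: "\<And>u v w e. u \<in> P \<Longrightarrow> v \<in> Q \<Longrightarrow> w \<in> R \<Longrightarrow> e \<in> U \<Longrightarrow>
      key f e < key f u \<Longrightarrow> key g e < key g v \<Longrightarrow> key h e < key h w"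
    and witness: "\<And>u v w. u \<in> P \<Longrightarrow> v \<in> Q \<Longrightarrow> w \<in> R \<Longrightarrow>
      \<exists>e\<in>U. key h u \<le> key h e \<and> key f e \<le> key f v \<and> key g e \<le> key g w"
    using three_order_partition [OF fin key_inj [OF inj(1)] key_inj [OF inj(2)] key_inj [OF inj(3)]
      key_cons cardU] by blast
  define T where "T i = (if i = 1 then P else if i = 2 then Q else R)" for i :: nat
  have T: "T 1 = P" "T (Suc 0) = P" "T 2 = Q" "T 3 = R" by (simp_all add: T_def)
  define B where "B i = fst ` T i" for i
  have sub: "P \<subseteq> U" "Q \<subseteq> U" "R \<subseteq> U" using PQR(1) by auto
  have le: "k a \<le> k b" if "key k (a, i) \<le> key k (b, j)" "inj k" "(a, i) \<in> U" "(b, j) \<in> U" for k a b i j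
    using key_less [OF that(2,4,3)] that(1) by auto
  have "B \<in> cell_family f g h"
  proof -
    have 1: "f a < f b" if mem: "a \<in> B 1" "b \<in> B 2" "a \<noteq> b" for a b
    proof -
      obtain i j where ij: "(a, i) \<in> P" "(b, j) \<in> Q" using mem(1,2) by (auto simp: B_def T)
      then have "(a, i) \<in> U" "(b, j) \<in> U" using sub by auto
      with key_less [OF inj(1) this] PQ [OF ij] mem(3) show ?thesis by blast
    qed
    have 2: "g b < g c" if mem: "b \<in> B 2" "c \<in> B 3" "b \<noteq> c" for b c
    proof -
      obtain i j where ij: "(b, i) \<in> Q" "(c, j) \<in> R" using mem(1,2) by (auto simp: B_def T)
      then have "(b, i) \<in> U" "(c, j) \<in> U" using sub by auto
      with key_less [OF inj(2) this] QR [OF ij] mem(3) show ?thesis by blast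
    qed
    have 3: "h a < h c" if mem: "a \<in> B 1" "c \<in> B 3" "a \<noteq> c" for a c
    proof -
      obtain i j where ij: "(a, i) \<in> P" "(c, j) \<in> R" using mem(1,2) by (auto simp: B_def T)
      then have "(a, i) \<in> U" "(c, j) \<in> U" using sub by auto
      with key_less [OF inj(3) this] PR [OF ij] mem(3) show ?thesis by blast
    qed
    have 4: "h e < h c" if mem: "a \<in> B 1" "b \<in> B 2" "c \<in> B 3" and less: "f e < f a" "g e < g b" for a b c e
    proof -
      obtain i j k where ijk: "(a, i) \<in> P" "(b, j) \<in> Q" "(c, k) \<in> R"
        using mem by (auto simp: B_def T)
      then have U: "(a, i) \<in> U" "(b, j) \<in> U" "(c, k) \<in> U" using sub by auto
      \<comment> \<open>any copy of \<open>e\<close> serves; for \<open>e = c\<close> take the given copy, which cannot lie below itself\<close>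
      define l where "l = (if e = c then k else 0)"
      have e: "(e, l) \<in> U" using U(3) pos [of e] by (auto simp: l_def U_def)
      have "key h (e, l) < key h (c, k)"
        by (rule out [OF ijk e])
          (use less key_less [OF inj(1) e U(1)] key_less [OF inj(2) e U(2)] in auto)
      then show ?thesis using key_less [OF inj(3) e U(3)] by (auto simp: l_def)
    qed
    have 5: "\<exists>e. f e < f a \<and> g e < g b \<and> h c \<le> h e"
      if mem: "c \<in> B 1" "a \<in> B 2" "b \<in> B 3" and less: "f a < f b" "h a < h c" for a b c
    proof -
      obtain i j k where ijk: "(c, k) \<in> P" "(a, i) \<in> Q" "(b, j) \<in> R"
        using mem by (auto simp: B_def T)
      then have U: "(a, i) \<in> U" "(b, j) \<in> U" "(c, k) \<in> U" using sub by auto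
      obtain e l where e: "(e, l) \<in> U" "key h (c, k) \<le> key h (e, l)"
        "key f (e, l) \<le> key f (a, i)" "key g (e, l) \<le> key g (b, j)"
        using witness [OF ijk] by auto
      have le_e: "h c \<le> h e" "f e \<le> f a" "g e \<le> g b"
        using le [OF e(2) inj(3) U(3) e(1)] le [OF e(3) inj(1) e(1) U(1)] le [OF e(4) inj(2) e(1) U(2)]
        by auto
      have "e \<noteq> a" using le_e(1) less(2) by auto
      moreover have "e \<noteq> b" using le_e(2) less(1) by auto
      ultimately have "f e < f a" "g e < g b"
        using le_e inj by (auto simp: less_le inj_eq)
      with le_e(1) show ?thesis by blast
    qed
    show ?thesis unfolding cell_family_def mem_Collect_eq
      by (intro conjI ballI allI impI)
        (erule (2) 1 | erule (2) 2 | erule (2) 3 | erule (4) 4 | erule (4) 5)+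
  qed
  moreover have "(\<chi> a. real (m a) / real M) \<in> mixed_sum 3 B"
  proof -
    have "0 < M"
    proof -
      have "0 < (\<Sum>a\<in>UNIV. m a)" using pos by (simp add: sum_pos)
      with M show ?thesis by simp
    qed
    define X where "X i a = real (card {u \<in> T i. fst u = a}) / real M" for i a
    have finT: "finite (T i)" for i using sub fin finite_subset by (auto simp: T_def)
    have cardT: "card (T i) = M" for i using PQR by (simp add: T_def)
    have count: "(\<Sum>a\<in>UNIV. card {u \<in> T i. fst u = a}) = card (T i)" for i
    proof -
      have "card (T i) = card (\<Union>a\<in>UNIV. {u \<in> T i. fst u = a})" by (rule arg_cong [of _ _ card]) auto
      also have "\<dots> = (\<Sum>a\<in>UNIV. card {u \<in> T i. fst u = a})"
        using finT by (intro card_UN_disjoint) auto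
      finally show ?thesis by simp
    qed
    have "plan 3 B X"
      unfolding plan_def
    proof (intro ballI conjI allI impI)
      fix i a
      show "0 \<le> X i a" by (simp add: X_def)
      show "X i a = 0" if "a \<notin> B i"
      proof -
        have "{u \<in> T i. fst u = a} = {}" using that unfolding B_def by blast
        then show ?thesis unfolding X_def by (simp only: card.empty of_nat_0 div_0)
      qed
      show "(\<Sum>a\<in>UNIV. X i a) = 1"
        using count [of i] cardT [of i] \<open>0 < M\<close>
        by (simp add: X_def flip: sum_divide_distrib of_nat_sum)
    qed
    moreover have "(\<chi> a. real (m a) / real M) = plan_sum 3 X"
    proof -
      have "card {u \<in> P. fst u = a} + card {u \<in> Q. fst u = a} + card {u \<in> R. fst u = a} = m a" for a
      proof -
        have "{u \<in> P. fst u = a} \<union> {u \<in> Q. fst u = a} \<union> {u \<in> R. fst u = a} = {a} \<times> {..<m a}"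
          using PQR(1) unfolding U_def by (auto simp: set_eq_iff)
        then have cell: "card ({u \<in> P. fst u = a} \<union> {u \<in> Q. fst u = a} \<union> {u \<in> R. fst u = a}) = m a"
          by (simp add: card_cartesian_product)
        have finite: "finite {u \<in> P. fst u = a}" "finite {u \<in> Q. fst u = a}" "finite {u \<in> R. fst u = a}"
          using finT [of 1] finT [of 2] finT [of 3] T by auto
        have PQ: "{u \<in> P. fst u = a} \<inter> {u \<in> Q. fst u = a} = {}"
          and PQ_R: "({u \<in> P. fst u = a} \<union> {u \<in> Q. fst u = a}) \<inter> {u \<in> R. fst u = a} = {}"
          using PQR(2-4) by blast+
        show ?thesis
          using cell card_Un_disjoint [OF finite(1,2) PQ]
            card_Un_disjoint [OF finite_UnI [OF finite(1,2)] finite(3) PQ_R] by simp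
      qed
      then have "real (m a) = card {u \<in> P. fst u = a} + card {u \<in> Q. fst u = a} + card {u \<in> R. fst u = a}" for a
        by metis
      then show ?thesis
        unfolding plan_sum_def vec_eq_iff atLeastAtMost_1_3
        by (simp add: X_def T add_divide_distrib)
    qed
    ultimately show ?thesis by (auto simp: mem_mixed_sum)
  qed
  ultimately show ?thesis by blast
qed

theorem theorem8p9:
  fixes \<sigma> :: "'d::finite \<Rightarrow> 'd \<Rightarrow> nat list"
  assumes "system_of_permutations 3 \<sigma>"
    and "acyclic_system 3 \<sigma>"
  shows "\<exists>(S :: (real ^ 'd) set set) L.
           fine_mixed_subdivision 3 S \<and> mixed_labeling 3 S L \<and>
           (\<forall>a b. a \<noteq> b \<longrightarrow> subdivision_system 3 S L a b = \<sigma> a b)"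
proof -
  have perm: "\<sigma> a b \<in> permutations_of_set {1..3}" and rev: "\<sigma> a b = rev (\<sigma> b a)" if "a \<noteq> b" for a b
    using assms(1) that unfolding system_of_permutations_def by blast+
  have word: "distinct (\<sigma> a b)" "set (\<sigma> a b) = {1..3}" if "a \<noteq> b" for a b
    using perm [OF that] by (auto simp: permutations_of_set_def)
  have flip: "appears_before i j (\<sigma> b a) \<longleftrightarrow> appears_before j i (\<sigma> a b)" if "a \<noteq> b" for a b i j
    using rev [OF that] by (metis appears_before_rev)
  have rank: "\<exists>k :: 'd \<Rightarrow> nat. inj k \<and> (\<forall>a b. k a < k b \<longleftrightarrow> (a, b) \<in> order_graph j i \<sigma>)"
    if ij: "i \<in> {1..3}" "j \<in> {1..3}" "i \<noteq> j" for i j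
  proof -
    have ac: "acyclic (order_graph j i \<sigma>)" using assms(2) ij by (auto simp: acyclic_system_def)
    have "(a, b) \<in> order_graph j i \<sigma> \<or> (b, a) \<in> order_graph j i \<sigma>" if ab: "a \<noteq> b" for a b
    proof -
      have "appears_before j i (\<sigma> a b) \<or> appears_before i j (\<sigma> a b)"
        by (rule appears_before_total) (use word(2) [OF ab] ij in auto)
      then show ?thesis using flip [OF ab, of j i] ab by (simp add: order_graph_def)
    qed
    from acyclic_total_rank [OF ac this] show ?thesis by metis
  qed
  \<comment> \<open>Moving from \<open>a\<close> to \<open>b\<close>, a summand that comes first in \<open>\<sigma> a b\<close> switches first, so summand 1 can be
    at \<open>a\<close> while summand 2 is at \<open>b\<close> only if 2 comes before 1.\<close>
  obtain f g h :: "'d \<Rightarrow> nat"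
    where f: "inj f" "\<And>a b. f a < f b \<longleftrightarrow> (a, b) \<in> order_graph 2 1 \<sigma>"
      and g: "inj g" "\<And>a b. g a < g b \<longleftrightarrow> (a, b) \<in> order_graph 3 2 \<sigma>"
      and h: "inj h" "\<And>a b. h a < h b \<longleftrightarrow> (a, b) \<in> order_graph 3 1 \<sigma>"
    using rank [of 1 2] rank [of 2 3] rank [of 1 3] by auto
  have cons: "h a < h b" if "f a < f b" "g a < g b" for a b
    using that appears_before_trans [OF word(1), of a b 3 2 1]
    unfolding f(2) g(2) h(2) order_graph_def by auto
  let ?F = "cell_family f g h"
  let ?S = "full_cells 3 ?F" and ?L = "label 3 ?F"
  have comp: "compatible 3 B B'" if "B \<in> ?F" "B' \<in> ?F" for B B'
    using that by (rule cell_family_compatible)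
  have S: "fine_mixed_subdivision 3 ?S"
    by (rule fine_mixed_subdivision_full_cells [OF _ comp cell_family_cover [OF f(1) g(1) h(1) cons]])
      auto
  have "subdivision_system 3 ?S ?L a b = \<sigma> a b" if ab: "a \<noteq> b" for a b
  proof (rule subdivision_system_label [OF _ ab perm [OF ab] comp])
    show "\<Union>?S = dilated_simplex 3" using S by (simp add: fine_mixed_subdivision_def)
    fix B i j assume B: "B \<in> ?F" and ij: "i \<in> {1..3}" "j \<in> {1..3}" "i \<noteq> j" and "a \<in> B i" "b \<in> B j"
    have 1: "appears_before 2 1 (\<sigma> x y)" if "x \<in> B 1" "y \<in> B 2" "x \<noteq> y" for x y
      using B f(2) that by (auto simp: cell_family_def order_graph_def)
    have 2: "appears_before 3 2 (\<sigma> x y)" if "x \<in> B 2" "y \<in> B 3" "x \<noteq> y" for x y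
      using B g(2) that by (auto simp: cell_family_def order_graph_def)
    have 3: "appears_before 3 1 (\<sigma> x y)" if "x \<in> B 1" "y \<in> B 3" "x \<noteq> y" for x y
      using B h(2) that by (auto simp: cell_family_def order_graph_def)
    show "appears_before j i (\<sigma> a b)"
      using ij \<open>a \<in> B i\<close> \<open>b \<in> B j\<close> ab flip [OF ab]
        1 [of a b] 1 [of b a] 2 [of a b] 2 [of b a] 3 [of a b] 3 [of b a]
      unfolding atLeastAtMost_1_3 by auto
  qed auto
  with S mixed_labeling_label [OF comp] show ?thesis by blast
qed

end
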